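(* Let $L\in\mathbb C^{N\times N}$ be invertible, let $\mathcal V$ be a linear map on Hermitian $N\times N$ matrices that maps positive semi-definite matrices to positive semi-definite matrices, and let $$P=\sup_{Q\succ0}\inf_{\mathbf v\ne0}\frac{\|L\mathbf v\|_Q^2}{\mathbf v^*\mathcal V[Q]\mathbf v}.$$ Let $\mathcal S:Q\mapsto\mathcal V[(L^{-1})^*QL^{-1}]$, an operator on Hermitian matrices. Then: (a) $\mathcal S$ preserves the cone of positive semi-definite matrices, and therefore it has a leading non-negative eigenvalue equal to its spectral radius $\operatorname{spec\,rad}\mathcal S\in[0,\infty)$; this eigenvalue has at least one (non-zero) positive semi-definite eigenmatrix. (b) $\operatorname{spec\,rad}\mathcal S=1/P$. (c) Let $\sigma_Q=\{\lambda\in\mathbb R:\exists\,\mathbf v\ne0,\ Q\mathbf v=\lambda\,\mathcal S[Q]\mathbf v\}$ be the generalised spectrum of $Q$ against $\mathcal S[Q]$. Then for any $Q\succeq0$ with $\mathcal S[Q]\succ0$, $$P\in[\min\sigma_Q,\ \max\sigma_Q].$$ (d) Suppose $\mathcal S$ is primitive, i.e. there exists $k$ such that $\mathcal S^k[Q]\succ0$ for all non-zero $Q\succeq0$. Then for all non-zero $Q\succeq0$, $$\min\sigma_{\mathcal S^k[Q]}\to P\quad\text{and}\quad\max\sigma_{\mathcal S^k[Q]}\to P\qquad\text{as }k\to\infty,$$ exponentially quickly.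
   Context: $Q\succ0$ (resp. $Q\succeq0$) means $Q$ is a Hermitian positive definite (resp. positive semi-definite) $N\times N$ complex matrix, and $\|\mathbf v\|_Q^2=\mathbf v^*Q\mathbf v$ for $\mathbf v\in\mathbb C^N$. In the definition of $P\in(0,\infty]$, a quotient with zero denominator is $+\infty$, and $1/\infty=0$. *)

theory Defs
  imports "HOL-Analysis.Analysis"
begin

definition conj_transpose :: "complex^'n^'m \<Rightarrow> complex^'m^'n" where
  "conj_transpose A = (\<chi> i j. cnj (A $ j $ i))"

definition hermitian :: "complex^'n^'n \<Rightarrow> bool" where
  "hermitian Q \<longleftrightarrow> conj_transpose Q = Q"

text \<open>The number $v^* Q v$; it is real whenever $Q$ is Hermitian, the only case in which
  this function is used, so that taking the real part only changes the type.\<close>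

definition qform :: "complex^'n^'n \<Rightarrow> complex^'n \<Rightarrow> real" where
  "qform Q v = Re (\<Sum>i\<in>UNIV. cnj (v $ i) * (Q *v v) $ i)"

definition pos_semidef :: "complex^'n^'n \<Rightarrow> bool" where
  "pos_semidef Q \<longleftrightarrow> hermitian Q \<and> (\<forall>v. 0 \<le> qform Q v)"

definition pos_def :: "complex^'n^'n \<Rightarrow> bool" where
  "pos_def Q \<longleftrightarrow> hermitian Q \<and> (\<forall>v. v \<noteq> 0 \<longrightarrow> 0 < qform Q v)"

text \<open>Hermitian matrices form a real (not complex) vector space. An operator on this space is
  a function on all matrices whose values outside the space are irrelevant.\<close>

definition hermitian_linear :: "(complex^'n^'n \<Rightarrow> complex^'n^'n) \<Rightarrow> bool" where
  "hermitian_linear F \<longleftrightarrow>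
     (\<forall>A. hermitian A \<longrightarrow> hermitian (F A)) \<and>
     (\<forall>A B. hermitian A \<longrightarrow> hermitian B \<longrightarrow> F (A + B) = F A + F B) \<and>
     (\<forall>c A. hermitian A \<longrightarrow> F (c *\<^sub>R A) = c *\<^sub>R F A)"

definition cscale :: "complex \<Rightarrow> complex^'n^'m \<Rightarrow> complex^'n^'m" where
  "cscale c A = (\<chi> i j. c * A $ i $ j)"

text \<open>The spectrum of a real-linear operator is that of its complexification. Every complex
  matrix is uniquely $H + \mathrm{i} K$ with $H = (A + A^*)/2$ and
  $K = (A - A^*)/(2\mathrm{i})$ Hermitian, so the complexification of the space of Hermitian
  matrices is the space of all complex matrices.\<close>

definition complexify ::
  "(complex^'n^'n \<Rightarrow> complex^'n^'n) \<Rightarrow> complex^'n^'n \<Rightarrow> complex^'n^'n" where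
  "complexify F A =
     F (cscale (1 / 2) (A + conj_transpose A)) +
     cscale \<i> (F (cscale (1 / (2 * \<i>)) (A - conj_transpose A)))"

definition spectrum_herm :: "(complex^'n^'n \<Rightarrow> complex^'n^'n) \<Rightarrow> complex set" where
  "spectrum_herm F = {\<mu>. \<exists>A. A \<noteq> 0 \<and> complexify F A = cscale \<mu> A}"

definition spec_rad :: "(complex^'n^'n \<Rightarrow> complex^'n^'n) \<Rightarrow> real" where
  "spec_rad F = Sup (cmod ` spectrum_herm F)"

definition ext_quotient :: "real \<Rightarrow> real \<Rightarrow> ereal" where
  "ext_quotient a b = (if b = 0 then \<infinity> else ereal (a / b))"

definition gen_spectrum :: "complex^'n^'n \<Rightarrow> complex^'n^'n \<Rightarrow> real set" where
  "gen_spectrum A B = {l. \<exists>v. v \<noteq> 0 \<and> A *v v = complex_of_real l *s (B *v v)}"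

text \<open>The exponent is positive: were \<open>k = 0\<close> allowed, every operator (even zero) would be
  primitive on \<open>1 \<times> 1\<close> matrices.\<close>

definition primitive_op :: "(complex^'n^'n \<Rightarrow> complex^'n^'n) \<Rightarrow> bool" where
  "primitive_op F \<longleftrightarrow>
     (\<exists>k\<ge>1. \<forall>Q. pos_semidef Q \<longrightarrow> Q \<noteq> 0 \<longrightarrow> pos_def ((F ^^ k) Q))"

end

theory Submission
  imports Defs
begin

text \<open>The substitution \<open>R = L\<^sup>* Q L\<close> shows that \<open>P\<close> is the supremum of all \<open>t\<close> for which some
  \<open>R \<succ> 0\<close> satisfies \<open>t \<S>[R] \<preceq> R\<close>. Brouwer's fixed point theorem on the section of the cone by the
  hyperplane of fixed trace gives \<open>R\<^sub>\<epsilon> \<succ> 0\<close> with \<open>\<S>[R\<^sub>\<epsilon>] + \<epsilon> I = r\<^sub>\<epsilon> R\<^sub>\<epsilon>\<close>, and a limit point as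
  \<open>\<epsilon> \<rightarrow> 0\<close> is a semi-definite eigenmatrix for \<open>r = lim r\<^sub>\<epsilon>\<close>. Comparing iterates of \<open>\<S>\<close> with
  multiples of \<open>R\<^sub>\<epsilon>\<close> bounds every eigenvalue of the complexification by \<open>r\<^sub>\<epsilon>\<close>, and the same comparison
  yields \<open>1/P = r\<close> and the enclosure of \<open>P\<close> by generalised eigenvalues. In the primitive case a
  power of \<open>\<S>/r\<close> maps the compact section of the cone into its interior, so the gap between the best
  constants in \<open>m X \<preceq> H \<preceq> M X\<close> (\<open>X\<close> the Perron eigenmatrix) shrinks by a fixed factor.\<close>

subsection \<open>Quadratic forms and semi-definite matrices\<close>

text \<open>The real inner product on \<open>complex^'n\<close> is the real part of the Hermitian
  one, so the conjugate transpose is still the adjoint. All later arguments about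
  \<open>qform\<close> can therefore run in a real Euclidean space.\<close>

lemma adjoint_inner:
  fixes A :: "complex^'n^'n"
  shows "x \<bullet> (A *v y) = (conj_transpose A *v x) \<bullet> y"
proof -
  have "x \<bullet> (A *v y) = (\<Sum>i\<in>UNIV. \<Sum>j\<in>UNIV. x $ i \<bullet> (A $ i $ j * y $ j))"
    by (simp add: inner_vec_def matrix_vector_mult_def inner_sum_right)
  also have "\<dots> = (\<Sum>i\<in>UNIV. \<Sum>j\<in>UNIV. (cnj (A $ i $ j) * x $ i) \<bullet> y $ j)"
    by (intro sum.cong refl) (simp add: inner_complex_def algebra_simps)
  also have "\<dots> = (\<Sum>j\<in>UNIV. \<Sum>i\<in>UNIV. (cnj (A $ i $ j) * x $ i) \<bullet> y $ j)"
    by (rule sum.swap)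
  also have "\<dots> = (conj_transpose A *v x) \<bullet> y"
    by (simp add: inner_vec_def matrix_vector_mult_def inner_sum_left conj_transpose_def)
  finally show ?thesis .
qed

lemma qform_inner: "qform Q v = v \<bullet> (Q *v v)"
  by (simp add: qform_def inner_vec_def inner_complex_def)

lemma hermitian_inner: "hermitian Q \<Longrightarrow> x \<bullet> (Q *v y) = (Q *v x) \<bullet> y"
  by (simp add: adjoint_inner hermitian_def)

lemma conj_transpose_conj_transpose [simp]: "conj_transpose (conj_transpose A) = A"
  by (simp add: conj_transpose_def vec_eq_iff)

lemma conj_transpose_add: "conj_transpose (A + B) = conj_transpose A + conj_transpose B"
  by (simp add: conj_transpose_def vec_eq_iff)

lemma conj_transpose_diff: "conj_transpose (A - B) = conj_transpose A - conj_transpose B"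
  by (simp add: conj_transpose_def vec_eq_iff)

lemma conj_transpose_scaleR: "conj_transpose (c *\<^sub>R A) = c *\<^sub>R conj_transpose A"
  by (simp add: conj_transpose_def vec_eq_iff)

lemma conj_transpose_mult: "conj_transpose (A ** B) = conj_transpose B ** conj_transpose A"
  by (simp add: conj_transpose_def vec_eq_iff matrix_matrix_mult_def mult.commute)

lemma conj_transpose_mat [simp]: "conj_transpose (mat 1) = mat 1"
  by (simp add: conj_transpose_def vec_eq_iff mat_def)

lemma conj_transpose_zero [simp]: "conj_transpose 0 = 0"
  by (simp add: conj_transpose_def vec_eq_iff)

lemma hermitian_zero [simp]: "hermitian 0"
  by (simp add: hermitian_def)

lemma hermitian_mat [simp]: "hermitian (mat 1)"
  by (simp add: hermitian_def)

lemma hermitian_add: "hermitian A \<Longrightarrow> hermitian B \<Longrightarrow> hermitian (A + B)"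
  by (simp add: hermitian_def conj_transpose_add)

lemma hermitian_diff: "hermitian A \<Longrightarrow> hermitian B \<Longrightarrow> hermitian (A - B)"
  by (simp add: hermitian_def conj_transpose_diff)

lemma hermitian_scaleR: "hermitian A \<Longrightarrow> hermitian (c *\<^sub>R A)"
  by (simp add: hermitian_def conj_transpose_scaleR)

lemmas hermitian_intros = hermitian_zero hermitian_mat hermitian_add hermitian_diff hermitian_scaleR

lemma scaleR_matrix_vector: "(c *\<^sub>R A) *v v = c *\<^sub>R (A *v v)" for A :: "complex^'n^'m"
  by (simp add: vec_eq_iff matrix_vector_mult_def scaleR_sum_right)

lemma matrix_vector_scaleR: "A *v (c *\<^sub>R v) = c *\<^sub>R (A *v v)" for A :: "complex^'n^'m"
  by (simp add: vec_eq_iff matrix_vector_mult_def scaleR_sum_right)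

lemma complex_of_real_scale: "complex_of_real l *s v = l *\<^sub>R v"
  by (simp add: vec_eq_iff scaleR_conv_of_real[where 'a=complex] del: scaleR_conv_of_real)

lemma gen_spectrum_scaleR:
  "gen_spectrum A B = {l. \<exists>v. v \<noteq> 0 \<and> A *v v = l *\<^sub>R (B *v v)}"
  by (simp add: gen_spectrum_def complex_of_real_scale)

lemma qform_zero [simp]: "qform 0 v = 0"
  by (simp add: qform_inner)

lemma qform_zero_right [simp]: "qform Q 0 = 0"
  by (simp add: qform_inner)

lemma qform_add: "qform (A + B) v = qform A v + qform B v"
  by (simp add: qform_inner matrix_vector_mult_add_rdistrib inner_add_right)

lemma qform_diff: "qform (A - B) v = qform A v - qform B v"
  by (simp add: qform_inner matrix_vector_mult_diff_rdistrib inner_diff_right)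

lemma qform_scaleR: "qform (c *\<^sub>R A) v = c * qform A v"
  by (simp add: qform_inner scaleR_matrix_vector)

lemma qform_scaleR_right: "qform A (c *\<^sub>R v) = c\<^sup>2 * qform A v"
  by (simp add: qform_inner matrix_vector_scaleR power2_eq_square)

lemma qform_mat [simp]: "qform (mat 1) v = v \<bullet> v"
  by (simp add: qform_inner)

lemmas qform_simps = qform_add qform_diff qform_scaleR

lemma qform_congruence: "qform (conj_transpose M ** Q ** M) v = qform Q (M *v v)"
  for M :: "complex^'n^'n"
  by (simp add: qform_inner adjoint_inner[of _ "conj_transpose M"]
      flip: matrix_vector_mul_assoc)

lemma hermitian_congruence: "hermitian Q \<Longrightarrow> hermitian (conj_transpose M ** Q ** M)"
  by (simp add: hermitian_def conj_transpose_mult matrix_mul_assoc)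

lemma pos_semidefI: "hermitian Q \<Longrightarrow> (\<And>v. 0 \<le> qform Q v) \<Longrightarrow> pos_semidef Q"
  by (simp add: pos_semidef_def)

lemma pos_defI: "hermitian Q \<Longrightarrow> (\<And>v. v \<noteq> 0 \<Longrightarrow> 0 < qform Q v) \<Longrightarrow> pos_def Q"
  by (simp add: pos_def_def)

lemma pos_def_imp_pos_semidef: "pos_def Q \<Longrightarrow> pos_semidef Q"
  unfolding pos_def_def pos_semidef_def by (metis less_eq_real_def qform_zero_right)

lemma pos_semidef_hermitian: "pos_semidef Q \<Longrightarrow> hermitian Q"
  by (simp add: pos_semidef_def)

lemma pos_def_hermitian: "pos_def Q \<Longrightarrow> hermitian Q"
  by (simp add: pos_def_def)

lemma pos_semidef_qform: "pos_semidef Q \<Longrightarrow> 0 \<le> qform Q v"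
  by (simp add: pos_semidef_def)

lemma pos_def_qform: "pos_def Q \<Longrightarrow> v \<noteq> 0 \<Longrightarrow> 0 < qform Q v"
  by (simp add: pos_def_def)

lemma pos_def_mat: "pos_def (mat 1)"
  by (rule pos_defI) auto

lemma vec_nonzero_ex: "\<exists>v::complex^'n. v \<noteq> 0"
  by (rule exI[of _ 1]) (simp add: vec_eq_iff)

lemma pos_def_nonzero: "pos_def (Q :: complex^'n^'n) \<Longrightarrow> Q \<noteq> 0"
  using vec_nonzero_ex[where 'n='n] by (auto simp: pos_def_def)

text \<open>Evaluate at the minimiser \<open>- b / c\<close>; if \<open>c = 0\<close>, an affine
  function bounded below has slope zero.\<close>

lemma quadratic_nonneg_discriminant:
  fixes a b c :: real
  assumes "\<And>t. 0 \<le> a + 2 * b * t + c * t\<^sup>2" "0 \<le> c"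
  shows "b\<^sup>2 \<le> a * c"
proof (cases "c = 0")
  case True
  have "b = 0"
  proof (rule ccontr)
    assume "b \<noteq> 0"
    \<comment> \<open>At this argument the affine function takes the value -1.\<close>
    then show False using assms(1)[of "- (a + 1) / (2 * b)"] True by (simp add: field_simps)
  qed
  then show ?thesis using True by simp
next
  case False
  then have "0 < c" using assms by simp
  have "0 \<le> a - b\<^sup>2 / c"
    using assms(1)[of "- b / c"] False by (simp add: field_simps power2_eq_square)
  then show ?thesis using \<open>0 < c\<close> by (simp add: field_simps)
qed

text \<open>Along the line \<open>x + t y\<close> the form of \<open>Q\<close> is a non-negative
  real quadratic in \<open>t\<close>.\<close>

lemma pos_semidef_Cauchy_Schwarz:
  assumes "pos_semidef Q"
  shows "(x \<bullet> (Q *v y))\<^sup>2 \<le> qform Q x * qform Q y"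
proof (rule quadratic_nonneg_discriminant)
  fix t
  have "x \<bullet> (Q *v y) = y \<bullet> (Q *v x)"
    using hermitian_inner[OF pos_semidef_hermitian[OF assms]] by (metis inner_commute)
  then have "qform Q (x + t *\<^sub>R y) = qform Q x + 2 * (x \<bullet> (Q *v y)) * t + qform Q y * t\<^sup>2"
    by (simp add: qform_inner matrix_vector_right_distrib matrix_vector_scaleR inner_add
        algebra_simps power2_eq_square)
  then show "0 \<le> qform Q x + 2 * (x \<bullet> (Q *v y)) * t + qform Q y * t\<^sup>2"
    using pos_semidef_qform[OF assms] by metis
qed (use assms pos_semidef_qform in auto)

text \<open>Cauchy-Schwarz with \<open>Q *v v\<close> as the other vector bounds the fourth power of
  its norm by zero.\<close>

lemma pos_semidef_null:
  assumes "pos_semidef Q" "qform Q v = 0"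
  shows "Q *v v = 0"
proof -
  have "((Q *v v) \<bullet> (Q *v v))\<^sup>2 \<le> 0"
    using pos_semidef_Cauchy_Schwarz[OF assms(1), of "Q *v v" v] assms(2) by simp
  then show ?thesis by simp
qed

text \<open>A vanishing form makes \<open>Q\<close> semi-definite with every vector null.\<close>

lemma hermitian_qform_eq_0:
  assumes "hermitian Q" "\<And>v. qform Q v = 0"
  shows "Q = 0"
proof -
  have "Q *v v = 0 *v v" for v
    using pos_semidef_null[of Q v] assms by (simp add: pos_semidef_def)
  then show ?thesis by (simp add: matrix_eq)
qed

section \<open>Continuity of forms and restriction to the unit sphere\<close>

lemma continuous_on_matrix_vector [continuous_intros]:
  fixes f :: "'a::topological_space \<Rightarrow> complex^'n^'m"
  assumes "continuous_on U f" "continuous_on U g"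
  shows "continuous_on U (\<lambda>x. f x *v g x)"
  unfolding matrix_vector_mult_def by (intro continuous_intros assms)

lemma continuous_on_qform [continuous_intros]:
  assumes "continuous_on U f" "continuous_on U g"
  shows "continuous_on U (\<lambda>x. qform (f x) (g x))"
  unfolding qform_inner by (intro continuous_intros assms)

lemma continuous_on_conj_transpose [continuous_intros]:
  assumes "continuous_on U f"
  shows "continuous_on U (\<lambda>x. conj_transpose (f x))"
  unfolding conj_transpose_def by (intro continuous_intros assms)

text \<open>Both sides are homogeneous of degree two in \<open>v\<close>.\<close>

lemma qform_ge_by_sphere:
  assumes "\<And>v. norm v = 1 \<Longrightarrow> qform A v \<le> qform B v"
  shows "qform A v \<le> qform B v"
proof (cases "v = 0")
  case False
  have "qform A (v /\<^sub>R norm v) \<le> qform B (v /\<^sub>R norm v)"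
    using False by (intro assms) simp
  then show ?thesis using False unfolding qform_scaleR_right
    by (simp add: mult_le_cancel_left)
qed simp

lemma sphere_complex_nonempty: "sphere (0::complex^'n) 1 \<noteq> {}"
proof -
  obtain v :: "complex^'n" where "v \<noteq> 0" using vec_nonzero_ex by blast
  then have "v /\<^sub>R norm v \<in> sphere 0 1" by simp
  then show ?thesis by blast
qed

subsection \<open>The generalised spectrum\<close>

text \<open>The least generalised eigenvalue is the minimum of the Rayleigh quotient: there, the
  semi-definite matrix \<open>A - l B\<close> has a null vector.\<close>

lemma gen_spectrum_min:
  fixes A B :: "complex^'n^'n"
  assumes A: "hermitian A" and B: "pos_def B"
  obtains l where "l \<in> gen_spectrum A B" "\<And>v. l * qform B v \<le> qform A v"
proof -
  define f where "f = (\<lambda>v. qform A v / qform B v)"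
  have nz: "v \<noteq> 0" if "v \<in> sphere 0 1" for v :: "complex^'n" using that by auto
  have "continuous_on (sphere 0 1) f"
    unfolding f_def using pos_def_qform[OF B] nz
    by (intro continuous_intros) (metis less_irrefl)
  then obtain u where u: "u \<in> sphere 0 1" "\<And>v. v \<in> sphere 0 1 \<Longrightarrow> f u \<le> f v"
    using continuous_attains_inf[of "sphere 0 1" f] sphere_complex_nonempty compact_sphere by metis
  define l where "l = f u"
  have le: "qform (l *\<^sub>R B) v \<le> qform A v" for v
  proof (rule qform_ge_by_sphere)
    fix v :: "complex^'n" assume "norm v = 1"
    then have v: "v \<in> sphere 0 1" by simp
    then have "l \<le> qform A v / qform B v" using u(2)[OF v] unfolding f_def l_def by simp
    then show "qform (l *\<^sub>R B) v \<le> qform A v"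
      using pos_def_qform[OF B nz[OF v]] by (simp add: qform_scaleR field_simps)
  qed
  have psd: "pos_semidef (A - l *\<^sub>R B)"
    using le A B by (intro pos_semidefI hermitian_intros) (auto simp: pos_def_hermitian qform_diff)
  have "qform (A - l *\<^sub>R B) u = 0"
    using pos_def_qform[OF B nz[OF u(1)]] by (simp add: qform_simps l_def f_def)
  then have "(A - l *\<^sub>R B) *v u = 0" by (rule pos_semidef_null[OF psd])
  then have "A *v u = l *\<^sub>R (B *v u)"
    by (simp add: matrix_vector_mult_diff_rdistrib scaleR_matrix_vector)
  then have "l \<in> gen_spectrum A B" using nz[OF u(1)] by (auto simp: gen_spectrum_scaleR)
  then show thesis using le by (intro that[of l]) (auto simp: qform_scaleR)
qed

text \<open>Negating \<open>A\<close> swaps minimum and maximum.\<close>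

lemma gen_spectrum_max:
  fixes A B :: "complex^'n^'n"
  assumes A: "hermitian A" and B: "pos_def B"
  obtains l where "l \<in> gen_spectrum A B" "\<And>v. qform A v \<le> l * qform B v"
proof -
  obtain l where l: "l \<in> gen_spectrum ((-1) *\<^sub>R A) B" "\<And>v. l * qform B v \<le> qform ((-1) *\<^sub>R A) v"
    using gen_spectrum_min[OF hermitian_scaleR[OF A] B] by blast
  obtain v where v: "v \<noteq> 0" "(-1) *\<^sub>R (A *v v) = l *\<^sub>R (B *v v)"
    using l(1) unfolding gen_spectrum_scaleR scaleR_matrix_vector by blast
  have "A *v v = (-1) *\<^sub>R ((-1) *\<^sub>R (A *v v))" by simp
  also have "\<dots> = (- l) *\<^sub>R (B *v v)" unfolding v(2) by simp
  finally have "- l \<in> gen_spectrum A B"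
    using v(1) by (auto simp: gen_spectrum_scaleR)
  moreover have "qform A v \<le> - l * qform B v" for v
    using l(2)[of v] unfolding qform_scaleR by simp
  ultimately show thesis by (rule that)
qed

lemma gen_spectrum_qform:
  assumes "l \<in> gen_spectrum A B"
  obtains v where "v \<noteq> 0" "qform A v = l * qform B v"
  using assms by (auto simp: gen_spectrum_scaleR qform_inner)

text \<open>Eigenvectors of different eigenvalues are orthogonal for the form of \<open>B\<close>, so there are
  at most as many eigenvalues as dimensions.\<close>

lemma finite_gen_spectrum:
  fixes A B :: "complex^'n^'n"
  assumes A: "hermitian A" and B: "pos_def B"
  shows "finite (gen_spectrum A B)"
proof -
  have "\<forall>l\<in>gen_spectrum A B. \<exists>v. v \<noteq> 0 \<and> A *v v = l *\<^sub>R (B *v v)"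
    by (auto simp: gen_spectrum_scaleR)
  then obtain e where e: "\<And>l. l \<in> gen_spectrum A B \<Longrightarrow> e l \<noteq> 0 \<and> A *v e l = l *\<^sub>R (B *v e l)"
    by metis
  have orth: "e l \<bullet> (B *v e m) = 0"
    if "l \<in> gen_spectrum A B" "m \<in> gen_spectrum A B" "l \<noteq> m" for l m
  proof -
    have "m * (e l \<bullet> (B *v e m)) = e l \<bullet> (A *v e m)" using e that by simp
    also have "\<dots> = (A *v e l) \<bullet> e m" by (rule hermitian_inner[OF A])
    also have "\<dots> = l * (e l \<bullet> (B *v e m))"
      using e[OF that(1)] hermitian_inner[OF pos_def_hermitian[OF B]] by simp
    finally show ?thesis using that(3) by simp
  qed
  have pos: "0 < e l \<bullet> (B *v e l)" if "l \<in> gen_spectrum A B" for l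
    using pos_def_qform[OF B] e[OF that] by (simp add: qform_inner)
  \<comment> \<open>A vector shared by two eigenvalues would be orthogonal to itself for the form of
    \<open>B\<close>.\<close>
  have inj: "inj_on e (gen_spectrum A B)"
    by (rule inj_onI) (metis orth pos less_irrefl)
  have "independent (e ` gen_spectrum A B)"
    unfolding independent_explicit_module
  proof (intro allI impI)
    fix T :: "(complex^'n) set" and c v
    assume T: "finite T" "T \<subseteq> e ` gen_spectrum A B" "(\<Sum>x\<in>T. c x *\<^sub>R x) = 0" "v \<in> T"
    obtain l where l: "l \<in> gen_spectrum A B" "v = e l" using T by blast
    have orth': "x \<bullet> (B *v v) = 0" if "x \<in> T" "x \<noteq> v" for x
      using T(2) that l orth by blast
    \<comment> \<open>Pairing the linear relation with \<open>B *v v\<close> isolates the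
      coefficient of \<open>v\<close>.\<close>
    have "0 = (\<Sum>x\<in>T. c x *\<^sub>R x) \<bullet> (B *v v)" by (simp add: T(3))
    also have "\<dots> = (\<Sum>x\<in>T. c x * (x \<bullet> (B *v v)))" by (simp add: inner_sum_left)
    also have "\<dots> = (\<Sum>x\<in>T. if x = v then c v * (v \<bullet> (B *v v)) else 0)"
      by (intro sum.cong refl) (auto simp: orth')
    also have "\<dots> = c v * (v \<bullet> (B *v v))" using T by simp
    finally show "c v = 0" using pos[OF l(1)] l(2) by simp
  qed
  then show ?thesis
    using finiteI_independent finite_imageD inj by blast
qed

lemma gen_spectrum_nonempty:
  "hermitian A \<Longrightarrow> pos_def B \<Longrightarrow> gen_spectrum A B \<noteq> {}"
  using gen_spectrum_min by (metis empty_iff)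

lemma Min_gen_spectrum_le:
  assumes "hermitian A" "pos_def B"
  shows "Min (gen_spectrum A B) * qform B v \<le> qform A v"
proof -
  obtain l where l: "l \<in> gen_spectrum A B" "\<And>v. l * qform B v \<le> qform A v"
    using gen_spectrum_min[OF assms] by blast
  have "Min (gen_spectrum A B) \<le> l" using finite_gen_spectrum[OF assms] l(1) by simp
  then show ?thesis
    using l(2)[of v] pos_semidef_qform[OF pos_def_imp_pos_semidef[OF assms(2)], of v]
    by (meson mult_right_mono order_trans)
qed

lemma Max_gen_spectrum_ge:
  assumes "hermitian A" "pos_def B"
  shows "qform A v \<le> Max (gen_spectrum A B) * qform B v"
proof -
  obtain l where l: "l \<in> gen_spectrum A B" "\<And>v. qform A v \<le> l * qform B v"
    using gen_spectrum_max[OF assms] by blast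
  have "l \<le> Max (gen_spectrum A B)" using finite_gen_spectrum[OF assms] l(1) by simp
  then show ?thesis
    using l(2)[of v] pos_semidef_qform[OF pos_def_imp_pos_semidef[OF assms(2)], of v]
    by (meson mult_right_mono order_trans)
qed

text \<open>A definite \<open>B\<close> is an order unit: the extreme generalised eigenvalues bound
  \<open>A\<close> from both sides. The summand 1 in the constant makes it strictly
  positive.\<close>

lemma pos_def_dominates:
  assumes "hermitian A" "pos_def B"
  obtains c where "0 < c" "\<And>v. \<bar>qform A v\<bar> \<le> c * qform B v"
proof -
  obtain l where l: "\<And>v. l * qform B v \<le> qform A v" using gen_spectrum_min[OF assms] by blast
  obtain m where m: "\<And>v. qform A v \<le> m * qform B v" using gen_spectrum_max[OF assms] by blast
  show thesis
  proof (rule that[of "\<bar>l\<bar> + \<bar>m\<bar> + 1"])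
    fix v
    have q: "0 \<le> qform B v" using assms(2) pos_def_imp_pos_semidef pos_semidef_qform by blast
    have "- (\<bar>l\<bar> * qform B v) \<le> l * qform B v" "m * qform B v \<le> \<bar>m\<bar> * qform B v"
      "0 \<le> \<bar>l\<bar> * qform B v" "0 \<le> \<bar>m\<bar> * qform B v"
      using q mult_right_mono[of "- \<bar>l\<bar>" l "qform B v"] mult_right_mono[of m "\<bar>m\<bar>" "qform B v"] by auto
    then show "\<bar>qform A v\<bar> \<le> (\<bar>l\<bar> + \<bar>m\<bar> + 1) * qform B v"
      using l[of v] m[of v] q unfolding distrib_right abs_le_iff mult_1 by linarith
  qed simp
qed

subsection \<open>Positive operators\<close>

definition positive_op :: "(complex^'n^'n \<Rightarrow> complex^'n^'n) \<Rightarrow> bool" where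
  "positive_op F \<longleftrightarrow> hermitian_linear F \<and> (\<forall>Q. pos_semidef Q \<longrightarrow> pos_semidef (F Q))"

lemma hermitian_linearD:
  assumes "hermitian_linear F"
  shows "hermitian A \<Longrightarrow> hermitian (F A)"
    and "hermitian A \<Longrightarrow> hermitian B \<Longrightarrow> F (A + B) = F A + F B"
    and "hermitian A \<Longrightarrow> F (c *\<^sub>R A) = c *\<^sub>R F A"
  using assms by (auto simp: hermitian_linear_def)

lemma hermitian_linear_diff:
  assumes "hermitian_linear F" "hermitian A" "hermitian B"
  shows "F (A - B) = F A - F B"
  using hermitian_linearD(2)[OF assms(1,2) hermitian_scaleR[OF assms(3)], of "-1"]
    hermitian_linearD(3)[OF assms(1,3), of "-1"] by simp

lemma hermitian_linear_zero: "hermitian_linear F \<Longrightarrow> F 0 = 0"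
  using hermitian_linearD(3)[of F 0 0] by simp

lemma positive_opD:
  assumes "positive_op F"
  shows "hermitian_linear F" "pos_semidef Q \<Longrightarrow> pos_semidef (F Q)"
  using assms by (auto simp: positive_op_def)

text \<open>Pointwise comparison of forms is the Loewner order, so positivity is applied to
  \<open>B - A\<close>.\<close>

lemma positive_op_mono:
  assumes F: "positive_op F" and "hermitian A" "hermitian B" "\<And>v. qform A v \<le> qform B v"
  shows "qform (F A) v \<le> qform (F B) v"
proof -
  have "pos_semidef (B - A)"
    using assms by (intro pos_semidefI hermitian_diff) (auto simp: qform_diff)
  then have "0 \<le> qform (F (B - A)) v" using positive_opD[OF F] pos_semidef_qform by blast
  then show ?thesis
    using hermitian_linear_diff[OF positive_opD(1)[OF F]] assms by (simp add: qform_diff)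
qed

lemma hermitian_linear_funpow:
  assumes "hermitian_linear F"
  shows "hermitian_linear (F ^^ k)"
  by (induction k) (use assms in \<open>auto simp: hermitian_linear_def\<close>)

lemma positive_op_funpow:
  assumes "positive_op F"
  shows "positive_op (F ^^ k)"
proof -
  have "pos_semidef ((F ^^ k) Q)" if "pos_semidef Q" for Q
    by (induction k) (use that assms in \<open>auto simp: positive_op_def\<close>)
  then show ?thesis
    using hermitian_linear_funpow[OF positive_opD(1)[OF assms]] by (simp add: positive_op_def)
qed

lemma positive_op_scaleR:
  assumes "positive_op F" "0 \<le> c"
  shows "positive_op (\<lambda>Q. c *\<^sub>R F Q)"
  using assms unfolding positive_op_def hermitian_linear_def
  by (auto simp: hermitian_scaleR scaleR_right_distrib pos_semidef_def qform_scaleR)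

text \<open>\<open>F\<close> is controlled only on Hermitian matrices. Precomposed with the
  projection \<open>h\<close> onto them it is linear everywhere, hence continuous in finite
  dimension, and it agrees with \<open>F\<close> on \<open>U\<close>.\<close>

lemma continuous_on_hermitian_linear:
  assumes F: "hermitian_linear F" and U: "\<And>Q. Q \<in> U \<Longrightarrow> hermitian Q"
  shows "continuous_on U F"
proof -
  define h where "h = (\<lambda>A::complex^'a^'a. (1/2) *\<^sub>R (A + conj_transpose A))"
  have herm: "hermitian (h A)" for A
    by (simp add: h_def hermitian_def conj_transpose_add conj_transpose_scaleR add.commute)
  have "linear (\<lambda>A. F (h A))"
  proof (rule linearI)
    fix A B :: "complex^'a^'a" and c :: real
    have "h (A + B) = h A + h B"
      by (simp add: h_def conj_transpose_add scaleR_right_distrib)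
    then show "F (h (A + B)) = F (h A) + F (h B)"
      using hermitian_linearD(2)[OF F herm herm] by simp
    have "h (c *\<^sub>R A) = c *\<^sub>R h A"
      by (simp add: h_def conj_transpose_scaleR scaleR_right_distrib mult.commute)
    then show "F (h (c *\<^sub>R A)) = c *\<^sub>R F (h A)"
      using hermitian_linearD(3)[OF F herm] by simp
  qed
  then have "continuous_on U (\<lambda>A. F (h A))"
    by (simp add: linear_continuous_on linear_linear)
  moreover have "h A = A" if "A \<in> U" for A
    using U[OF that] by (simp add: h_def hermitian_def flip: scaleR_2)
  ultimately show ?thesis by (metis (mono_tags, lifting) continuous_on_cong)
qed

text \<open>Twice the real part of the trace, since the real basis consists of the vectors
  \<open>e\<^sub>i\<close> and \<open>\<i> e\<^sub>i\<close>.\<close>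

definition qtrace :: "complex^'n^'n \<Rightarrow> real" where
  "qtrace Q = (\<Sum>b\<in>Basis. qform Q b)"

section \<open>Trace bounds and the compact base of the cone\<close>

lemma qtrace_add: "qtrace (A + B) = qtrace A + qtrace B"
  by (simp add: qtrace_def qform_add sum.distrib)

lemma qtrace_diff: "qtrace (A - B) = qtrace A - qtrace B"
  by (simp add: qtrace_def qform_diff sum_subtractf)

lemma qtrace_scaleR: "qtrace (c *\<^sub>R A) = c * qtrace A"
  by (simp add: qtrace_def qform_scaleR sum_distrib_left)

lemma qtrace_nonneg: "pos_semidef A \<Longrightarrow> 0 \<le> qtrace A"
  by (simp add: qtrace_def sum_nonneg pos_semidef_qform)

lemma qtrace_pos: "pos_def A \<Longrightarrow> 0 < qtrace A"
  unfolding qtrace_def by (intro sum_pos) (auto intro: pos_def_qform)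

lemma continuous_on_qtrace [continuous_intros]:
  "continuous_on U f \<Longrightarrow> continuous_on U (\<lambda>x. qtrace (f x))"
  unfolding qtrace_def by (intro continuous_intros)

text \<open>By Cauchy-Schwarz an entry is at most the geometric mean of two diagonal ones, each
  bounded by the sum of all of them.\<close>

lemma qtrace_entry_bound:
  assumes A: "pos_semidef A" and "x \<in> Basis" "y \<in> Basis"
  shows "\<bar>x \<bullet> (A *v y)\<bar> \<le> qtrace A"
proof (rule power2_le_imp_le)
  have le: "qform A b \<le> qtrace A" if "b \<in> Basis" for b
    unfolding qtrace_def using that A by (intro member_le_sum) (auto simp: pos_semidef_qform)
  have "(x \<bullet> (A *v y))\<^sup>2 \<le> qform A x * qform A y"
    by (rule pos_semidef_Cauchy_Schwarz[OF A])
  also have "\<dots> \<le> qtrace A * qtrace A"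
    using assms by (intro mult_mono le) (auto simp: pos_semidef_qform qtrace_nonneg)
  finally show "\<bar>x \<bullet> (A *v y)\<bar>\<^sup>2 \<le> (qtrace A)\<^sup>2" by (simp add: power2_eq_square)
qed (rule qtrace_nonneg[OF A])

text \<open>On the cone the trace controls the norm. This makes \<open>cone_base\<close> bounded and
  gives non-zero semi-definite matrices positive trace.\<close>

lemma qtrace_norm_bound:
  obtains C where "\<And>A :: complex^'n^'n. pos_semidef A \<Longrightarrow> norm A \<le> C * qtrace A"
proof (rule that)
  fix A :: "complex^'n^'n" assume A: "pos_semidef A"
  have "norm (A $ i $ j) \<le> DIM(complex^'n) * qtrace A" for i j
  proof -
    \<comment> \<open>Column \<open>j\<close>, whose real coordinates are the pairings bounded in
      \<open>qtrace_entry_bound\<close>.\<close>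
    have "A *v axis j 1 = (\<chi> i. A $ i $ j)"
      by (simp add: vec_eq_iff matrix_vector_mult_def axis_def if_distrib cong: if_cong)
    then have "norm (A $ i $ j) \<le> norm (A *v axis j 1)"
      using Finite_Cartesian_Product.norm_nth_le[of "A *v axis j 1" i] by simp
    also have "\<dots> \<le> (\<Sum>b\<in>Basis. \<bar>(A *v axis j 1) \<bullet> b\<bar>)" by (rule norm_le_l1)
    also have "\<dots> \<le> (\<Sum>b\<in>(Basis :: (complex^'n) set). qtrace A)"
      by (intro sum_mono) (simp add: inner_commute[of "A *v _"] qtrace_entry_bound[OF A]
          axis_in_Basis_iff Basis_complex_def)
    finally show ?thesis by simp
  qed
  then have "norm A \<le> (\<Sum>i\<in>(UNIV::'n set). \<Sum>j\<in>(UNIV::'n set). DIM(complex^'n) * qtrace A)"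
    unfolding norm_vec_def[of A] norm_vec_def[of "A $ _"]
    by (intro order_trans[OF L2_set_le_sum] sum_mono L2_set_nonneg norm_ge_zero)
  then show "norm A \<le> (real CARD('n) * real CARD('n) * DIM(complex^'n)) * qtrace A"
    by simp
qed

lemma qtrace_pos_nonzero:
  assumes "pos_semidef (A :: complex^'n^'n)" "A \<noteq> 0"
  shows "0 < qtrace A"
proof -
  obtain C where "\<And>A :: complex^'n^'n. pos_semidef A \<Longrightarrow> norm A \<le> C * qtrace A"
    using qtrace_norm_bound by blast
  then have "qtrace A \<noteq> 0" using assms by fastforce
  then show ?thesis using qtrace_nonneg[OF assms(1)] by simp
qed

text \<open>A base of the cone: every non-zero semi-definite matrix scales to a point of it.
  Compactness serves fixed points, limits and minima; convexity serves Brouwer's theorem.\<close>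

definition cone_base :: "(complex^'n^'n) set" where
  "cone_base = {Q. pos_semidef Q \<and> qtrace Q = 1}"

lemma compact_cone_base: "compact (cone_base :: (complex^'n^'n) set)"
proof -
  obtain C where C: "\<And>A :: complex^'n^'n. pos_semidef A \<Longrightarrow> norm A \<le> C * qtrace A"
    using qtrace_norm_bound by blast
  have bounded: "bounded (cone_base :: (complex^'n^'n) set)"
    unfolding bounded_iff cone_base_def using C by fastforce
  have eq: "cone_base = {Q::complex^'n^'n. conj_transpose Q = Q} \<inter> (\<Inter>v. {Q. 0 \<le> qform Q v})
      \<inter> {Q. qtrace Q = 1}"
    by (auto simp: cone_base_def pos_semidef_def hermitian_def)
  moreover have "closed {Q::complex^'n^'n. conj_transpose Q = Q}"
    by (intro closed_Collect_eq continuous_intros)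
  moreover have "closed {Q::complex^'n^'n. 0 \<le> qform Q v}" for v
    by (intro closed_Collect_le continuous_intros)
  moreover have "closed {Q::complex^'n^'n. qtrace Q = 1}"
    by (intro closed_Collect_eq continuous_intros)
  ultimately have "closed (cone_base :: (complex^'n^'n) set)"
    unfolding eq by (intro closed_Int closed_INT ballI) auto
  with bounded show ?thesis by (simp add: compact_eq_bounded_closed)
qed

lemma convex_cone_base: "convex cone_base"
  by (rule convexI)
    (auto simp: cone_base_def qtrace_add qtrace_scaleR pos_semidef_def hermitian_intros qform_simps)

lemma normalize_cone_base:
  assumes "pos_semidef A" "A \<noteq> 0"
  shows "(1 / qtrace A) *\<^sub>R A \<in> cone_base"
  using assms qtrace_pos_nonzero[OF assms]
  by (auto simp: cone_base_def qtrace_scaleR pos_semidef_def hermitian_scaleR qform_scaleR)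

subsection \<open>The leading eigenvalue\<close>

text \<open>Brouwer's theorem is applied to \<open>G\<close> followed by normalisation. The summand
  \<open>e *\<^sub>R mat 1\<close> makes every value of \<open>G\<close> definite, so the trace
  never vanishes; the fixed point is a positive multiple of its image and so definite too.\<close>

lemma perturbed_eigenmatrix:
  fixes F :: "complex^'n^'n \<Rightarrow> complex^'n^'n"
  assumes F: "positive_op F" and e: "0 < e"
  obtains Q r where "Q \<in> cone_base" "pos_def Q" "0 < r" "F Q + e *\<^sub>R mat 1 = r *\<^sub>R Q"
proof -
  define G where "G = (\<lambda>Q. F Q + e *\<^sub>R mat 1)"
  have herm: "hermitian Q" if "Q \<in> cone_base" for Q :: "complex^'n^'n"
    using that by (auto simp: cone_base_def pos_semidef_def)
  have pd: "pos_def (G Q)" if "Q \<in> cone_base" for Q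
  proof (rule pos_defI)
    have psd: "pos_semidef (F Q)" using that positive_opD(2)[OF F] by (auto simp: cone_base_def)
    show "hermitian (G Q)"
      unfolding G_def by (intro hermitian_intros pos_semidef_hermitian psd)
    fix v :: "complex^'n" assume "v \<noteq> 0"
    then show "0 < qform (G Q) v"
      using pos_semidef_qform[OF psd, of v] e by (simp add: G_def qform_simps add_nonneg_pos)
  qed
  have tr_nz: "qtrace (G Q) \<noteq> 0" if "Q \<in> cone_base" for Q
    using qtrace_pos[OF pd[OF that]] by simp
  have "continuous_on cone_base F"
    by (rule continuous_on_hermitian_linear[OF positive_opD(1)[OF F] herm])
  then have cont: "continuous_on cone_base (\<lambda>Q. (1 / qtrace (G Q)) *\<^sub>R G Q)"
    using tr_nz unfolding G_def by (intro continuous_intros ballI) blast+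
  have into: "(\<lambda>Q. (1 / qtrace (G Q)) *\<^sub>R G Q) \<in> cone_base \<rightarrow> cone_base"
    using pd by (auto intro!: normalize_cone_base pos_def_imp_pos_semidef dest: pos_def_nonzero)
  have "cone_base \<noteq> ({} :: (complex^'n^'n) set)"
    using normalize_cone_base[OF pos_def_imp_pos_semidef pos_def_nonzero, OF pos_def_mat pos_def_mat]
    by blast
  then obtain Q where Q: "Q \<in> cone_base" "(1 / qtrace (G Q)) *\<^sub>R G Q = Q"
    using brouwer[OF compact_cone_base convex_cone_base _ cont into] by blast
  have tr: "0 < qtrace (G Q)" by (rule qtrace_pos[OF pd[OF Q(1)]])
  have eq: "G Q = qtrace (G Q) *\<^sub>R Q"
    using tr arg_cong[OF Q(2), of "\<lambda>A. qtrace (G Q) *\<^sub>R A"] by simp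
  have "pos_def Q"
  proof (rule pos_defI[OF herm[OF Q(1)]])
    fix v :: "complex^'n" assume "v \<noteq> 0"
    then have "0 < qform (qtrace (G Q) *\<^sub>R Q) v" using pos_def_qform[OF pd[OF Q(1)]] eq by simp
    then show "0 < qform Q v" using tr by (simp add: qform_scaleR zero_less_mult_iff)
  qed
  then show thesis using that Q(1) tr eq unfolding G_def by blast
qed

text \<open>A Perron eigenmatrix as a limit of eigenmatrices of perturbations; the approximating
  definite matrices are kept because they bound the spectrum from above.\<close>

lemma leading_eigenmatrix:
  fixes F :: "complex^'n^'n \<Rightarrow> complex^'n^'n"
  assumes F: "positive_op F"
  obtains Q r where "pos_semidef Q" "Q \<noteq> 0" "0 \<le> r" "F Q = r *\<^sub>R Q"
    "\<And>s. r < s \<Longrightarrow> \<exists>R. pos_def R \<and> (\<forall>v. qform (F R) v \<le> s * qform R v)"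
proof -
  have "\<forall>n. \<exists>Q r. Q \<in> cone_base \<and> pos_def Q \<and> 0 < r
      \<and> F Q + inverse (Suc n) *\<^sub>R mat 1 = r *\<^sub>R Q"
    using perturbed_eigenmatrix[OF F] by (metis inverse_positive_iff_positive of_nat_0_less_iff zero_less_Suc)
  then obtain X q where X: "\<And>n. X n \<in> cone_base" "\<And>n. pos_def (X n)" "\<And>n. 0 < q n"
    "\<And>n. F (X n) + inverse (Suc n) *\<^sub>R mat 1 = q n *\<^sub>R X n"
    by metis
  obtain Q h where Q: "Q \<in> cone_base" "strict_mono h" "(X \<circ> h) \<longlonglongrightarrow> Q"
    using compact_cone_base X(1) unfolding compact_def by blast
  have herm: "hermitian Q" if "Q \<in> cone_base" for Q :: "complex^'n^'n"
    using that by (auto simp: cone_base_def pos_semidef_def)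
  have contF: "continuous_on cone_base F"
    by (rule continuous_on_hermitian_linear[OF positive_opD(1)[OF F] herm])
  have e0: "(\<lambda>n. inverse (real (Suc (h n)))) \<longlonglongrightarrow> 0"
    using LIMSEQ_subseq_LIMSEQ[OF LIMSEQ_inverse_real_of_nat Q(2)] by (simp add: o_def)
  have XQ: "(\<lambda>n. X (h n)) \<longlonglongrightarrow> Q" using Q(3) by (simp add: o_def)
  have FX: "(\<lambda>n. F (X (h n))) \<longlonglongrightarrow> F Q"
    using continuous_on_tendsto_compose[OF contF XQ Q(1)] X(1) by simp
  have G: "(\<lambda>n. F (X (h n)) + inverse (real (Suc (h n))) *\<^sub>R mat 1) \<longlonglongrightarrow> F Q"
    using tendsto_add[OF FX tendsto_scaleR[OF e0 tendsto_const[of "mat 1"]]] by simp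
  \<comment> \<open>Taking traces in the eigen-equation expresses \<open>q n\<close> through
    \<open>F (X n)\<close>, so convergence of the matrices forces convergence of the
    eigenvalues.\<close>
  have q: "q n = qtrace (F (X n) + inverse (real (Suc n)) *\<^sub>R mat 1)" for n
    using X(1)[of n] X(4)[of n] by (simp add: cone_base_def qtrace_scaleR)
  have "continuous_on UNIV (qtrace :: complex^'n^'n \<Rightarrow> real)" by (intro continuous_intros)
  then have qlim: "(\<lambda>n. q (h n)) \<longlonglongrightarrow> qtrace (F Q)"
    unfolding q by (rule continuous_on_tendsto_compose[OF _ G UNIV_I]) simp
  have "(\<lambda>n. q (h n) *\<^sub>R X (h n)) \<longlonglongrightarrow> qtrace (F Q) *\<^sub>R Q"
    by (intro tendsto_intros qlim XQ)
  then have eig: "F Q = qtrace (F Q) *\<^sub>R Q"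
    using G unfolding X(4) by (intro LIMSEQ_unique)
  have psd: "pos_semidef Q" "Q \<noteq> 0" using Q(1) by (auto simp: cone_base_def qtrace_def)
  show thesis
  proof (rule that[OF psd _ eig])
    show "0 \<le> qtrace (F Q)" using qtrace_nonneg positive_opD(2)[OF F psd(1)] by blast
    fix s assume "qtrace (F Q) < s"
    then have "\<forall>\<^sub>F n in sequentially. q (h n) < s" by (rule order_tendstoD(2)[OF qlim])
    then obtain n where n: "q (h n) < s" using eventually_happens by fastforce
    \<comment> \<open>Dropping the semi-definite perturbation turns the eigen-equation into an
      inequality.\<close>
    have "qform (F (X m)) v \<le> s * qform (X m) v" if "m = h n" for v m
    proof -
      have "qform (F (X m)) v \<le> qform (F (X m) + inverse (real (Suc m)) *\<^sub>R mat 1) v"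
        by (simp add: qform_simps)
      also have "\<dots> = q m * qform (X m) v" unfolding X(4) qform_scaleR ..
      also have "\<dots> \<le> s * qform (X m) v"
        using n that X(2) pos_def_imp_pos_semidef pos_semidef_qform by (intro mult_right_mono) auto
      finally show ?thesis .
    qed
    then show "\<exists>R. pos_def R \<and> (\<forall>v. qform (F R) v \<le> s * qform R v)" using X(2) by blast
  qed
qed

section \<open>Growth of iterates of super- and sub-invariant matrices\<close>

lemma super_invariant_funpow:
  assumes F: "positive_op F" and R: "pos_def R" and s: "0 \<le> s"
    and le: "\<And>v. qform (F R) v \<le> s * qform R v"
  shows "qform ((F ^^ k) R) v \<le> s ^ k * qform R v"
proof (induction k arbitrary: v)
  case (Suc k)
  have hR: "hermitian R" by (rule pos_def_hermitian[OF R])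
  have "qform ((F ^^ Suc k) R) v \<le> qform (F (s ^ k *\<^sub>R R)) v"
    using Suc hermitian_linearD(1)[OF hermitian_linear_funpow[OF positive_opD(1)[OF F]] hR]
    by (simp, intro positive_op_mono[OF F]) (auto simp: qform_scaleR hermitian_scaleR hR)
  also have "\<dots> = s ^ k * qform (F R) v"
    using hermitian_linearD(3)[OF positive_opD(1)[OF F] hR] by (simp add: qform_scaleR)
  also have "\<dots> \<le> s ^ k * (s * qform R v)"
    by (intro mult_left_mono le) (simp add: s)
  finally show ?case by (simp add: mult_ac)
qed simp

lemma super_invariant_nonneg:
  fixes R :: "complex^'n^'n"
  assumes F: "positive_op F" and R: "pos_def R" and le: "\<And>v. qform (F R) v \<le> s * qform R v"
  shows "0 \<le> s"
proof -
  obtain v :: "complex^'n" where "v \<noteq> 0" using vec_nonzero_ex by blast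
  then have "0 < qform R v" by (rule pos_def_qform[OF R])
  moreover have "0 \<le> qform (F R) v"
    by (intro pos_semidef_qform positive_opD(2)[OF F] pos_def_imp_pos_semidef R)
  ultimately show ?thesis using le[of v] by (meson le_less_trans mult_less_0_iff not_less order_less_irrefl)
qed

lemma sub_invariant_funpow:
  assumes F: "positive_op F" and Q: "hermitian Q" and l: "0 \<le> l"
    and le: "\<And>v. l * qform Q v \<le> qform (F Q) v"
  shows "l ^ k * qform Q v \<le> qform ((F ^^ k) Q) v"
proof (induction k arbitrary: v)
  case (Suc k)
  have "l ^ Suc k * qform Q v \<le> l ^ k * qform (F Q) v"
    using mult_left_mono[OF le[of v], of "l ^ k"] l by (simp add: mult_ac)
  also have "\<dots> = qform (F (l ^ k *\<^sub>R Q)) v"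
    using hermitian_linearD(3)[OF positive_opD(1)[OF F] Q] by (simp add: qform_scaleR)
  also have "\<dots> \<le> qform ((F ^^ Suc k) Q) v"
    using Suc hermitian_linearD(1)[OF hermitian_linear_funpow[OF positive_opD(1)[OF F]] Q]
    by (simp, intro positive_op_mono[OF F]) (auto simp: qform_scaleR hermitian_scaleR Q)
  finally show ?case .
qed simp

text \<open>Here \<open>l\<close> is positive, and division by \<open>l ^ k\<close> bounds
  \<open>x\<close> by a sequence tending to 0.\<close>

lemma geometric_domination_nonpos:
  fixes x y s l :: real
  assumes "0 \<le> s" "s < l" "\<And>k::nat. l ^ k * x \<le> s ^ k * y"
  shows "x \<le> 0"
proof (rule LIMSEQ_le_const)
  show "(\<lambda>k. (s / l) ^ k * y) \<longlonglongrightarrow> 0"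
    using assms by (intro tendsto_mult_left_zero LIMSEQ_power_zero) auto
  have "x \<le> (s / l) ^ k * y" for k
    using assms(1,2) assms(3)[of k] by (simp add: power_divide field_simps)
  then show "\<exists>N. \<forall>k\<ge>N. x \<le> (s / l) ^ k * y" by blast
qed

text \<open>If \<open>s < l\<close>, iteration gives
  \<open>l^k Q <= F^k Q <= c F^k R <= c s^k R\<close>, which forces \<open>Q <= 0\<close> as
  \<open>k\<close> grows. Definiteness of \<open>R\<close> provides the constant
  \<open>c\<close>.\<close>

lemma sub_le_super_invariant:
  assumes F: "positive_op F" and Q: "pos_semidef Q" "Q \<noteq> 0" and R: "pos_def R"
    and sub: "\<And>v. l * qform Q v \<le> qform (F Q) v"
    and super: "\<And>v. qform (F R) v \<le> s * qform R v"
  shows "l \<le> s"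
proof (rule ccontr)
  assume "\<not> l \<le> s"
  then have sl: "s < l" by simp
  have s: "0 \<le> s" by (rule super_invariant_nonneg[OF F R super])
  have hQ: "hermitian Q" and hR: "hermitian R"
    using Q R by (auto simp: pos_semidef_def pos_def_def)
  obtain c where c: "0 < c" "\<And>v. \<bar>qform Q v\<bar> \<le> c * qform R v"
    using pos_def_dominates[OF hQ R] by blast
  have "qform Q v \<le> 0" for v
  proof (rule geometric_domination_nonpos[OF s sl])
    fix k
    have Fk: "positive_op (F ^^ k)" by (rule positive_op_funpow[OF F])
    have "l ^ k * qform Q v \<le> qform ((F ^^ k) Q) v"
      using s sl by (intro sub_invariant_funpow[OF F hQ _ sub]) simp
    also have "\<dots> \<le> qform ((F ^^ k) (c *\<^sub>R R)) v"
      using c(2) hQ hR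
      by (intro positive_op_mono[OF Fk]) (auto simp: hermitian_scaleR qform_scaleR intro: abs_le_D1)
    also have "\<dots> = c * qform ((F ^^ k) R) v"
      using hermitian_linearD(3)[OF positive_opD(1)[OF Fk] hR] by (simp add: qform_scaleR)
    also have "\<dots> \<le> c * (s ^ k * qform R v)"
      using c(1) by (intro mult_left_mono super_invariant_funpow[OF F R s super]) auto
    finally show "l ^ k * qform Q v \<le> s ^ k * (c * qform R v)" by (simp add: mult_ac)
  qed
  then have "qform Q v = 0" for v using pos_semidef_qform[OF Q(1)] by (meson antisym)
  then show False using hermitian_qform_eq_0[OF hQ] Q(2) by blast
qed

section \<open>Eigenvalues of the complexification\<close>

lemma cscale_component [simp]: "cscale c A $ i $ j = c * A $ i $ j"
  by (simp add: cscale_def)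

lemma cscale_of_real: "cscale (complex_of_real r) A = r *\<^sub>R A"
  by (simp add: vec_eq_iff) (simp add: scaleR_conv_of_real)

lemma cscale_zero [simp]: "cscale c 0 = 0"
  by (simp add: vec_eq_iff)

lemma hermitian_component: "hermitian A \<Longrightarrow> cnj (A $ j $ i) = A $ i $ j"
  unfolding hermitian_def conj_transpose_def by (metis vec_lambda_beta)

text \<open>Conjugate transposition sends \<open>A + i B\<close> to \<open>A - i B\<close>, and
  these two together determine \<open>A\<close> and \<open>B\<close>.\<close>

lemma hermitian_decomposition_unique:
  assumes "hermitian A" "hermitian B" "hermitian C" "hermitian D"
    and eq: "A + cscale \<i> B = C + cscale \<i> D"
  shows "A = C \<and> B = D"
proof -
  have "A $ i $ j = C $ i $ j \<and> B $ i $ j = D $ i $ j" for i j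
  proof -
    have 1: "A $ i $ j + \<i> * B $ i $ j = C $ i $ j + \<i> * D $ i $ j" for i j
      using arg_cong[OF eq, of "\<lambda>M. M $ i $ j"] by simp
    have 2: "A $ i $ j - \<i> * B $ i $ j = C $ i $ j - \<i> * D $ i $ j"
      using arg_cong[OF 1[of j i], of cnj] assms(1-4) by (simp add: hermitian_component)
    have "2 * A $ i $ j = 2 * C $ i $ j" using arg_cong2[OF 1[of i j] 2, of "(+)"] by simp
    then show ?thesis using 2 by simp
  qed
  then show ?thesis by (simp add: vec_eq_iff)
qed

text \<open>If \<open>H + \<i>K\<close> is an eigenmatrix for \<open>\<mu>\<close>, then \<open>F\<close> acts on the real span of \<open>H\<close> and \<open>K\<close>,
  identified with the complex numbers, as multiplication by \<open>cnj \<mu>\<close>.\<close>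

lemma spectrum_herm_rotation:
  fixes F :: "complex^'n^'n \<Rightarrow> complex^'n^'n"
  assumes F: "hermitian_linear F" and "\<mu> \<in> spectrum_herm F"
  obtains H K where "hermitian H" "hermitian K" "H \<noteq> 0 \<or> K \<noteq> 0"
    "\<And>w. F (Re w *\<^sub>R H + Im w *\<^sub>R K) = Re (cnj \<mu> * w) *\<^sub>R H + Im (cnj \<mu> * w) *\<^sub>R K"
proof -
  obtain Z where Z: "Z \<noteq> 0" "complexify F Z = cscale \<mu> Z"
    using assms(2) by (auto simp: spectrum_herm_def)
  define H where "H = cscale (1 / 2) (Z + conj_transpose Z)"
  define K where "K = cscale (1 / (2 * \<i>)) (Z - conj_transpose Z)"
  have H: "hermitian H" and K: "hermitian K"
    by (simp_all add: hermitian_def H_def K_def conj_transpose_def vec_eq_iff field_simps)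
  have ZHK: "Z = H + cscale \<i> K"
    by (simp add: H_def K_def vec_eq_iff field_simps)
  have "F H + cscale \<i> (F K) = cscale \<mu> (H + cscale \<i> K)"
    using Z(2) unfolding complexify_def H_def[symmetric] K_def[symmetric] ZHK[symmetric] .
  \<comment> \<open>Sorted into a Hermitian part and i times a Hermitian part, so that uniqueness
    reads off \<open>F H\<close> and \<open>F K\<close>.\<close>
  also have "\<dots> = (Re \<mu> *\<^sub>R H - Im \<mu> *\<^sub>R K) + cscale \<i> (Im \<mu> *\<^sub>R H + Re \<mu> *\<^sub>R K)"
    by (simp add: vec_eq_iff complex_eq_iff algebra_simps)
  finally have FHK: "F H = Re \<mu> *\<^sub>R H - Im \<mu> *\<^sub>R K" "F K = Im \<mu> *\<^sub>R H + Re \<mu> *\<^sub>R K"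
    using hermitian_decomposition_unique hermitian_linearD(1)[OF F] H K hermitian_intros by metis+
  show thesis
  proof (rule that[OF H K])
    show "H \<noteq> 0 \<or> K \<noteq> 0" using Z(1) ZHK by auto
    fix w
    have "F (Re w *\<^sub>R H + Im w *\<^sub>R K) = Re w *\<^sub>R F H + Im w *\<^sub>R F K"
      using hermitian_linearD[OF F] H K hermitian_scaleR by metis
    also have "\<dots> = Re (cnj \<mu> * w) *\<^sub>R H + Im (cnj \<mu> * w) *\<^sub>R K"
      unfolding FHK by (simp add: algebra_simps)
    finally show "F (Re w *\<^sub>R H + Im w *\<^sub>R K) = Re (cnj \<mu> * w) *\<^sub>R H + Im (cnj \<mu> * w) *\<^sub>R K" .
  qed
qed

text \<open>On the span of \<open>H\<close> and \<open>K\<close> the \<open>k\<close>-th iterate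
  scales by \<open>|\<mu>|^k\<close>, while comparison with \<open>R\<close> allows growth by at
  most \<open>s^k\<close>. If \<open>s < |\<mu>|\<close>, every \<open>W u\<close> is thereby
  squeezed below zero.\<close>

lemma spectrum_herm_le_super_invariant:
  fixes F :: "complex^'n^'n \<Rightarrow> complex^'n^'n"
  assumes F: "positive_op F" and R: "pos_def R"
    and super: "\<And>v. qform (F R) v \<le> s * qform R v"
    and mu: "\<mu> \<in> spectrum_herm F"
  shows "cmod \<mu> \<le> s"
proof (rule ccontr)
  assume "\<not> cmod \<mu> \<le> s"
  then have sl: "s < cmod \<mu>" by simp
  have s: "0 \<le> s" by (rule super_invariant_nonneg[OF F R super])
  have hR: "hermitian R" by (rule pos_def_hermitian[OF R])
  obtain H K where H: "hermitian H" and K: "hermitian K" and nz: "H \<noteq> 0 \<or> K \<noteq> 0"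
    and rot: "\<And>w. F (Re w *\<^sub>R H + Im w *\<^sub>R K) = Re (cnj \<mu> * w) *\<^sub>R H + Im (cnj \<mu> * w) *\<^sub>R K"
    by (rule spectrum_herm_rotation[OF positive_opD(1)[OF F] mu]) (rule that)
  define W where "W = (\<lambda>w. Re w *\<^sub>R H + Im w *\<^sub>R K)"
  have hW: "hermitian (W w)" for w unfolding W_def by (intro hermitian_intros H K)
  have FW1: "F (W w) = W (cnj \<mu> * w)" for w unfolding W_def by (rule rot)
  have FW: "(F ^^ k) (W w) = W (cnj \<mu> ^ k * w)" for k w
    by (induction k) (simp_all add: FW1 mult.assoc)
  obtain a where a: "0 < a" "\<And>v. \<bar>qform H v\<bar> \<le> a * qform R v"
    using pos_def_dominates[OF H R] by blast
  obtain b where b: "0 < b" "\<And>v. \<bar>qform K v\<bar> \<le> b * qform R v"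
    using pos_def_dominates[OF K R] by blast
  have qW: "qform (W w) v \<le> cmod w * (a + b) * qform R v" for w v
  proof -
    have "Re w * qform H v \<le> cmod w * (a * qform R v)"
      using abs_ge_self[of "Re w * qform H v"] mult_mono[OF abs_Re_le_cmod a(2), of w v]
      by (simp add: abs_mult)
    moreover have "Im w * qform K v \<le> cmod w * (b * qform R v)"
      using abs_ge_self[of "Im w * qform K v"] mult_mono[OF abs_Im_le_cmod b(2), of w v]
      by (simp add: abs_mult)
    ultimately show ?thesis by (simp add: W_def qform_simps algebra_simps)
  qed
  have W0: "qform (W u) v \<le> 0" for u v
  proof (rule geometric_domination_nonpos[OF s sl])
    fix k
    have Fk: "positive_op (F ^^ k)" by (rule positive_op_funpow[OF F])
    have \<mu>0: "\<mu> \<noteq> 0" using s sl by auto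
    \<comment> \<open>The starting point that \<open>k\<close> applications of \<open>F\<close>
      carry to \<open>u\<close>; its modulus is \<open>|u| / |\<mu>|^k\<close>.\<close>
    define w where "w = u / cnj \<mu> ^ k"
    define c where "c = cmod w * (a + b)"
    have "W u = (F ^^ k) (W w)" using \<mu>0 by (simp add: FW w_def)
    then have "qform (W u) v \<le> qform ((F ^^ k) (c *\<^sub>R R)) v"
      using qW[of w] hW hR
      by (simp, intro positive_op_mono[OF Fk]) (auto simp: hermitian_scaleR qform_scaleR c_def)
    also have "\<dots> = c * qform ((F ^^ k) R) v"
      using hermitian_linearD(3)[OF positive_opD(1)[OF Fk] hR] by (simp add: qform_scaleR)
    also have "\<dots> \<le> c * (s ^ k * qform R v)"
      using a(1) b(1)
      by (intro mult_left_mono super_invariant_funpow[OF F R s super]) (auto simp: c_def)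
    also have "c = cmod u * (a + b) / cmod \<mu> ^ k"
      by (simp add: c_def w_def norm_divide norm_power)
    finally show "cmod \<mu> ^ k * qform (W u) v \<le> s ^ k * (cmod u * (a + b) * qform R v)"
      using \<mu>0 by (simp add: field_simps)
  qed
  \<comment> \<open>The choices 1, -1, i and -i of \<open>u\<close> turn \<open>W u\<close> into
    \<open>H\<close>, \<open>-H\<close>, \<open>K\<close> and \<open>-K\<close>.\<close>
  have "qform H v = 0" "qform K v = 0" for v
    using W0[of 1 v] W0[of "-1" v] W0[of \<i> v] W0[of "-\<i>" v]
    unfolding W_def qform_simps by simp_all
  then show False using hermitian_qform_eq_0 H K nz by blast
qed

text \<open>The imaginary part of the Hermitian \<open>Q\<close> vanishes, so \<open>Q\<close> is an
  eigenmatrix of the complexification. The matrices in \<open>approx\<close> bound all eigenvalues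
  as \<open>s\<close> decreases to \<open>r\<close>.\<close>

lemma leading_eigenvalue_spec_rad:
  fixes F :: "complex^'n^'n \<Rightarrow> complex^'n^'n"
  assumes F: "positive_op F" and Q: "pos_semidef Q" "Q \<noteq> 0" and r: "0 \<le> r"
    and eig: "F Q = r *\<^sub>R Q"
    and approx: "\<And>s. r < s \<Longrightarrow> \<exists>R. pos_def R \<and> (\<forall>v. qform (F R) v \<le> s * qform R v)"
  shows "spec_rad F = r" "complex_of_real r \<in> spectrum_herm F"
    "\<And>\<mu>. \<mu> \<in> spectrum_herm F \<Longrightarrow> cmod \<mu> \<le> r"
proof -
  have "complexify F Q = F Q"
  proof -
    have "cscale (1 / 2) (Q + conj_transpose Q) = Q" "cscale (1 / (2 * \<i>)) (Q - conj_transpose Q) = 0"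
      using pos_semidef_hermitian[OF Q(1)] by (simp_all add: hermitian_def vec_eq_iff)
    then show ?thesis
      using hermitian_linear_zero[OF positive_opD(1)[OF F]] unfolding complexify_def by simp
  qed
  then show mem: "complex_of_real r \<in> spectrum_herm F"
    using Q(2) eig unfolding spectrum_herm_def by (auto simp: cscale_of_real intro!: exI[of _ Q])
  show le: "cmod \<mu> \<le> r" if "\<mu> \<in> spectrum_herm F" for \<mu>
    using approx spectrum_herm_le_super_invariant[OF F] that by (meson dense_ge)
  show "spec_rad F = r"
    unfolding spec_rad_def using mem le r
    by (intro cSup_eq_maximum) (auto intro!: image_eqI[of _ _ "complex_of_real r"])
qed

subsection \<open>The Collatz-Wielandt number\<close>

text \<open>The number \<open>P\<close> in the case where \<open>L\<close> is the identity and
  \<open>V\<close> is \<open>F\<close>; its reciprocal turns out to be the spectral radius of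
  \<open>F\<close>.\<close>

definition collatz_wielandt :: "(complex^'n^'n \<Rightarrow> complex^'n^'n) \<Rightarrow> ereal" where
  "collatz_wielandt F = (SUP R\<in>{R. pos_def R}. INF v\<in>{v. v \<noteq> 0}.
     ext_quotient (qform R v) (qform (F R) v))"

text \<open>Where the denominator vanishes the quotient is infinite and the bound trivial; elsewhere
  the denominator is positive.\<close>

lemma collatz_wielandt_ge:
  assumes F: "positive_op F" and R: "pos_def R" and le: "\<And>v. t * qform (F R) v \<le> qform R v"
  shows "ereal t \<le> collatz_wielandt F"
  unfolding collatz_wielandt_def
proof (rule SUP_upper2[of R])
  show "ereal t \<le> (INF v\<in>{v. v \<noteq> 0}. ext_quotient (qform R v) (qform (F R) v))"
  proof (rule INF_greatest)
    fix v
    have "0 \<le> qform (F R) v"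
      using positive_opD(2)[OF F] R pos_def_imp_pos_semidef pos_semidef_qform by blast
    then show "ereal t \<le> ext_quotient (qform R v) (qform (F R) v)"
      using le[of v] by (auto simp: ext_quotient_def field_simps)
  qed
qed (use R in simp)

text \<open>If the supremum exceeded \<open>b\<close>, some \<open>R\<close> would have infimum
  above \<open>b\<close>, and a real \<open>t\<close> strictly between them would contradict
  \<open>le\<close>.\<close>

lemma collatz_wielandt_le:
  assumes F: "positive_op F" and b: "0 \<le> b"
    and le: "\<And>R t. pos_def R \<Longrightarrow> 0 < t \<Longrightarrow> (\<And>v. t * qform (F R) v \<le> qform R v) \<Longrightarrow> t \<le> b"
  shows "collatz_wielandt F \<le> ereal b"
  unfolding collatz_wielandt_def
proof (rule SUP_least, rule ccontr)
  fix R :: "complex^'a^'a" assume "R \<in> {R. pos_def R}"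
  then have R: "pos_def R" by simp
  assume "\<not> (INF v\<in>{v. v \<noteq> 0}. ext_quotient (qform R v) (qform (F R) v)) \<le> ereal b"
  then have "ereal b < (INF v\<in>{v. v \<noteq> 0}. ext_quotient (qform R v) (qform (F R) v))"
    by simp
  then obtain t where t: "b < t"
    "ereal t < (INF v\<in>{v. v \<noteq> 0}. ext_quotient (qform R v) (qform (F R) v))"
    using ereal_dense2 less_ereal.simps(1) by blast
  have "t * qform (F R) v \<le> qform R v" for v
  proof (cases "v = 0")
    case False
    have "0 \<le> qform (F R) v" "0 \<le> qform R v"
      using positive_opD(2)[OF F] R pos_def_imp_pos_semidef pos_semidef_qform by blast+
    moreover have "ereal t < ext_quotient (qform R v) (qform (F R) v)"
      using t(2) False by (meson INF_lower less_le_trans mem_Collect_eq)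
    \<comment> \<open>At a zero denominator the claim reduces to
      \<open>0 <= qform R v\<close>.\<close>
    ultimately show ?thesis by (auto simp: ext_quotient_def field_simps split: if_splits)
  qed simp
  then show False using le[OF R, of t] t(1) b by simp
qed

text \<open>The identity competes in the supremum with value at least \<open>1 / c\<close>.\<close>

lemma collatz_wielandt_pos:
  assumes F: "positive_op F"
  shows "0 < collatz_wielandt F"
proof -
  have "hermitian (F (mat 1))"
    by (rule hermitian_linearD(1)[OF positive_opD(1)[OF F] hermitian_mat])
  then obtain c where c: "0 < c" "\<And>v. \<bar>qform (F (mat 1)) v\<bar> \<le> c * qform (mat 1) v"
    using pos_def_dominates[OF _ pos_def_mat] by blast
  have "ereal (1 / c) \<le> collatz_wielandt F"
    using c abs_le_D1[OF c(2)] by (intro collatz_wielandt_ge[OF F pos_def_mat]) (simp add: field_simps)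
  moreover have "0 < ereal (1 / c)" using c by simp
  ultimately show ?thesis by (rule less_le_trans[rotated])
qed

text \<open>Definite matrices with \<open>F R <= s R\<close> show that the value is at least
  \<open>1 / s\<close> for each \<open>s > r\<close>. Conversely \<open>t F R <= R\<close> makes
  \<open>R\<close> super-invariant with factor \<open>1 / t\<close>, and comparison with the
  eigenmatrix \<open>Q\<close> gives \<open>r <= 1 / t\<close>.\<close>

lemma collatz_wielandt_eq:
  assumes F: "positive_op F" and Q: "pos_semidef Q" "Q \<noteq> 0" and r: "0 \<le> r"
    and eig: "F Q = r *\<^sub>R Q"
    and approx: "\<And>s. r < s \<Longrightarrow> \<exists>R. pos_def R \<and> (\<forall>v. qform (F R) v \<le> s * qform R v)"
  shows "collatz_wielandt F = (if r = 0 then \<infinity> else ereal (1 / r))"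
proof -
  have ge: "ereal (1 / s) \<le> collatz_wielandt F" if rs: "r < s" for s
  proof -
    obtain R where "pos_def R" "\<And>v. qform (F R) v \<le> s * qform R v" using approx[OF rs] by blast
    then show ?thesis using rs r by (intro collatz_wielandt_ge[OF F]) (auto simp: field_simps)
  qed
  show ?thesis
  proof (cases "r = 0")
    case True
    have "ereal B \<le> collatz_wielandt F" for B
    proof -
      \<comment> \<open>The choice \<open>s = 1 / (\<bar>B\<bar> + 1)\<close> is positive and has
        reciprocal at least \<open>B\<close>.\<close>
      have "ereal B \<le> ereal (1 / (1 / (\<bar>B\<bar> + 1)))" by simp
      also have "\<dots> \<le> collatz_wielandt F" by (rule ge) (simp add: True)
      finally show ?thesis .
    qed
    then show ?thesis using True by (simp add: ereal_top)
  next
    case False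
    then have r0: "0 < r" using r by simp
    have "collatz_wielandt F \<le> ereal (1 / r)"
    proof (rule collatz_wielandt_le[OF F])
      fix R and t :: real
      assume R: "pos_def R" "0 < t" "\<And>v. t * qform (F R) v \<le> qform R v"
      have "qform (F R) v \<le> 1 / t * qform R v" for v
        using R(2) R(3)[of v] by (simp add: field_simps)
      then have "r \<le> 1 / t"
        by (rule sub_le_super_invariant[OF F Q R(1), rotated]) (simp add: eig qform_scaleR)
      then show "t \<le> 1 / r" using R(2) r0 by (simp add: field_simps)
    qed (use r in simp)
    moreover have "ereal (1 / r) \<le> collatz_wielandt F"
    proof (rule dense_le)
      fix y assume y: "y < ereal (1 / r)"
      show "y \<le> collatz_wielandt F"
      proof (cases "y \<le> 0")
        case True
        then show ?thesis using collatz_wielandt_pos[OF F] by simp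
      next
        case False
        then obtain t where t: "y = ereal t" "0 < t" using y by (cases y) auto
        then have "r < 1 / t" using y r0 by (simp add: field_simps)
        then show ?thesis using ge[of "1 / t"] t by simp
      qed
    qed
    ultimately show ?thesis using False by simp
  qed
qed

text \<open>The extreme eigenvalues satisfy \<open>m F Q <= Q <= M F Q\<close>. If
  \<open>m > 0\<close>, the left inequality makes \<open>Q\<close> definite, hence admissible in the
  supremum; otherwise positivity of the supremum suffices. The right one makes \<open>Q\<close>
  sub-invariant with factor \<open>1 / M\<close>.\<close>

lemma collatz_wielandt_bounds:
  fixes F :: "complex^'n^'n \<Rightarrow> complex^'n^'n"
  assumes F: "positive_op F" and Q: "pos_semidef Q" and FQ: "pos_def (F Q)"
  shows "ereal (Min (gen_spectrum Q (F Q))) \<le> collatz_wielandt F"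
    and "collatz_wielandt F \<le> ereal (Max (gen_spectrum Q (F Q)))"
proof -
  have hQ: "hermitian Q" by (rule pos_semidef_hermitian[OF Q])
  define m where "m = Min (gen_spectrum Q (F Q))"
  define M where "M = Max (gen_spectrum Q (F Q))"
  have m: "m * qform (F Q) v \<le> qform Q v" for v
    unfolding m_def by (rule Min_gen_spectrum_le[OF hQ FQ])
  have M: "qform Q v \<le> M * qform (F Q) v" for v
    unfolding M_def by (rule Max_gen_spectrum_ge[OF hQ FQ])
  have Q0: "Q \<noteq> 0"
    using pos_def_nonzero[OF FQ] hermitian_linear_zero[OF positive_opD(1)[OF F]] by auto
  have "ereal m \<le> collatz_wielandt F"
  proof (cases "m \<le> 0")
    case True
    then have "ereal m \<le> 0" by simp
    then show ?thesis using collatz_wielandt_pos[OF F] by (meson less_imp_le order_trans)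
  next
    case False
    have "pos_def Q"
    proof (rule pos_defI[OF hQ])
      fix v :: "complex^'n" assume "v \<noteq> 0"
      then have "0 < m * qform (F Q) v" using False pos_def_qform[OF FQ] by simp
      then show "0 < qform Q v" using m[of v] by simp
    qed
    then show ?thesis using m by (rule collatz_wielandt_ge[OF F])
  qed
  then show "ereal (Min (gen_spectrum Q (F Q))) \<le> collatz_wielandt F" by (simp add: m_def)
  \<comment> \<open>Testing where the form of \<open>Q\<close> does not vanish yields
    \<open>M > 0\<close>.\<close>
  obtain u where u: "qform Q u \<noteq> 0" using hermitian_qform_eq_0[OF hQ] Q0 by blast
  then have "0 < qform Q u" using pos_semidef_qform[OF Q, of u] by simp
  then have "0 < M * qform (F Q) u" using M[of u] by simp
  then have M0: "0 < M"
    using pos_semidef_qform[OF pos_def_imp_pos_semidef[OF FQ], of u] by (simp add: zero_less_mult_iff)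
  have "collatz_wielandt F \<le> ereal M"
  proof (rule collatz_wielandt_le[OF F])
    fix R and t :: real
    assume R: "pos_def R" "0 < t" "\<And>v. t * qform (F R) v \<le> qform R v"
    have "qform (F R) v \<le> 1 / t * qform R v" for v
      using R(2) R(3)[of v] by (simp add: field_simps)
    moreover have "1 / M * qform Q v \<le> qform (F Q) v" for v
      using M0 M[of v] by (simp add: field_simps)
    ultimately have "1 / M \<le> 1 / t"
      by (rule sub_le_super_invariant[OF F Q Q0 R(1), rotated])
    then show "t \<le> M" using R(2) M0 by (simp add: field_simps)
  qed (use M0 in simp)
  then show "collatz_wielandt F \<le> ereal (Max (gen_spectrum Q (F Q)))" by (simp add: M_def)
qed

section \<open>Congruence by an invertible matrix\<close>

lemma pos_def_congruence:
  assumes Q: "pos_def Q" and M: "invertible (M :: complex^'n^'n)"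
  shows "pos_def (conj_transpose M ** Q ** M)"
proof (rule pos_defI)
  show "hermitian (conj_transpose M ** Q ** M)"
    by (rule hermitian_congruence[OF pos_def_hermitian[OF Q]])
  fix v :: "complex^'n" assume "v \<noteq> 0"
  then have "M *v v \<noteq> 0"
    using M by (metis invertible_def matrix_vector_mul_assoc matrix_vector_mul_lid matrix_vector_mult_0_right)
  then show "0 < qform (conj_transpose M ** Q ** M) v"
    unfolding qform_congruence by (rule pos_def_qform[OF Q])
qed

lemma congruence_inverse:
  assumes "M ** M' = mat 1"
  shows "conj_transpose M' ** (conj_transpose M ** Q ** M) ** M' = (Q :: complex^'n^'n)"
proof -
  have "conj_transpose M' ** (conj_transpose M ** Q ** M) ** M'
      = conj_transpose (M ** M') ** Q ** (M ** M')"
    by (simp add: conj_transpose_mult matrix_mul_assoc)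
  then show ?thesis using assms by simp
qed

text \<open>The congruence \<open>T\<close> maps the definite matrices onto themselves, which
  reindexes the supremum. It turns \<open>S\<close> into \<open>V\<close> and evaluation at
  \<open>v\<close> into evaluation at \<open>L *v v\<close>.\<close>

lemma collatz_wielandt_congruence:
  fixes L :: "complex^'n^'n"
  assumes L: "invertible L"
    and S: "S = (\<lambda>Q. V (conj_transpose (matrix_inv L) ** Q ** matrix_inv L))"
  shows "(SUP Q\<in>{Q. pos_def Q}. INF v\<in>{v. v \<noteq> 0}.
            ext_quotient (qform Q (L *v v)) (qform (V Q) v)) = collatz_wielandt S"
proof -
  define T where "T = (\<lambda>Q. conj_transpose L ** Q ** L)"
  have LL: "L ** matrix_inv L = mat 1" "matrix_inv L ** L = mat 1"
    using someI_ex[OF L[unfolded invertible_def]] by (auto simp: matrix_inv_def)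
  have invL: "invertible (matrix_inv L)" using LL by (auto simp: invertible_def)
  have ST: "S (T Q) = V Q" for Q
    unfolding S T_def congruence_inverse[OF LL(1)] ..
  have surj: "T ` {Q. pos_def Q} = {Q. pos_def Q}"
  proof
    show "T ` {Q. pos_def Q} \<subseteq> {Q. pos_def Q}"
      using pos_def_congruence[OF _ L] by (auto simp: T_def)
    show "{Q. pos_def Q} \<subseteq> T ` {Q. pos_def Q}"
    proof
      fix Q :: "complex^'n^'n" assume "Q \<in> {Q. pos_def Q}"
      then have "pos_def (conj_transpose (matrix_inv L) ** Q ** matrix_inv L)"
        using pos_def_congruence[OF _ invL] by simp
      moreover have "Q = T (conj_transpose (matrix_inv L) ** Q ** matrix_inv L)"
        unfolding T_def congruence_inverse[OF LL(2)] ..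
      ultimately show "Q \<in> T ` {Q. pos_def Q}" by blast
    qed
  qed
  have "collatz_wielandt S = (SUP Q\<in>{Q. pos_def Q}. INF v\<in>{v. v \<noteq> 0}.
      ext_quotient (qform (T Q) v) (qform (S (T Q)) v))"
    unfolding collatz_wielandt_def by (subst surj[symmetric]) (simp add: image_image)
  then show ?thesis by (simp add: ST) (simp add: T_def qform_congruence)
qed

lemma positive_op_congruence:
  assumes V: "positive_op V"
  shows "positive_op (\<lambda>Q. V (conj_transpose M ** Q ** M))"
proof -
  have "pos_semidef (conj_transpose M ** Q ** M)" if "pos_semidef Q" for Q
    using that by (simp add: pos_semidef_def hermitian_congruence qform_congruence)
  moreover have "conj_transpose M ** (A + B) ** M
      = conj_transpose M ** A ** M + conj_transpose M ** B ** M" for A B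
    by (simp add: matrix_eq matrix_vector_mult_add_rdistrib matrix_vector_right_distrib
        flip: matrix_vector_mul_assoc)
  moreover have "conj_transpose M ** (c *\<^sub>R A) ** M = c *\<^sub>R (conj_transpose M ** A ** M)" for c A
    by (simp add: matrix_eq scaleR_matrix_vector matrix_vector_scaleR flip: matrix_vector_mul_assoc)
  ultimately show ?thesis
    using V unfolding positive_op_def hermitian_linear_def by (simp add: hermitian_congruence)
qed

subsection \<open>Primitive operators\<close>

text \<open>The form of \<open>G Q\<close> is continuous and positive on the compact product of
  \<open>cone_base\<close> and the unit sphere, so it has a positive minimum there. Homogeneity
  extends the bound to the whole cone, and \<open>c\<close> converts the identity into
  \<open>X\<close>.\<close>

lemma positive_definite_op_lower_bound:
  fixes G :: "complex^'n^'n \<Rightarrow> complex^'n^'n"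
  assumes G: "positive_op G" and pd: "\<And>Q. pos_semidef Q \<Longrightarrow> Q \<noteq> 0 \<Longrightarrow> pos_def (G Q)"
    and X: "hermitian X"
  obtains d where "0 < d" "\<And>Q v. pos_semidef Q \<Longrightarrow> d * qtrace Q * qform X v \<le> qform (G Q) v"
proof -
  define B where "B = (cone_base :: (complex^'n^'n) set) \<times> sphere (0::complex^'n) 1"
  define f where "f = (\<lambda>p. qform (G (fst p)) (snd p))"
  have base: "pos_semidef Q \<and> Q \<noteq> 0" if "Q \<in> cone_base" for Q :: "complex^'n^'n"
    using that by (auto simp: cone_base_def qtrace_def)
  have "continuous_on cone_base G"
    using base pos_semidef_hermitian
    by (intro continuous_on_hermitian_linear[OF positive_opD(1)[OF G]]) blast
  then have "continuous_on B f"
    unfolding f_def B_def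
    by (intro continuous_intros continuous_on_compose2[where f = fst and g = G]) auto
  moreover have "compact B" unfolding B_def by (intro compact_Times compact_cone_base) auto
  moreover have "B \<noteq> {}"
    using sphere_complex_nonempty
      normalize_cone_base[OF pos_def_imp_pos_semidef pos_def_nonzero, OF pos_def_mat pos_def_mat]
    unfolding B_def by blast
  ultimately obtain p where p: "p \<in> B" "\<And>q. q \<in> B \<Longrightarrow> f p \<le> f q"
    using continuous_attains_inf[of B f] by blast
  have "snd p \<noteq> 0" using p(1) by (auto simp: B_def)
  then have fp: "0 < f p"
    using p(1) base pd pos_def_qform unfolding f_def B_def by (metis mem_Times_iff)
  obtain c where c: "0 < c" "\<And>v. \<bar>qform X v\<bar> \<le> c * qform (mat 1) v"
    using pos_def_dominates[OF X pos_def_mat] by blast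
  have low: "f p / c * qform X v \<le> qform (G Q) v" if Q: "Q \<in> cone_base" for Q v
  proof -
    have "qform ((f p / c) *\<^sub>R X) v \<le> qform (G Q) v"
    proof (rule qform_ge_by_sphere)
      fix v :: "complex^'n" assume v: "norm v = 1"
      have "qform X v \<le> c" using abs_le_D1[OF c(2)[of v]] v by (simp add: dot_square_norm)
      then have "f p * qform X v \<le> f p * c" using fp by simp
      then have "f p / c * qform X v \<le> f p" using c(1) by (simp add: field_simps)
      also have "f p \<le> f (Q, v)" using Q v by (intro p(2)) (simp add: B_def)
      finally show "qform ((f p / c) *\<^sub>R X) v \<le> qform (G Q) v" by (simp add: f_def qform_scaleR)
    qed
    then show ?thesis by (simp add: qform_scaleR)
  qed
  show thesis
  proof (rule that[of "f p / c"])
    show "0 < f p / c" using fp c(1) by simp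
    fix Q :: "complex^'n^'n" and v assume Q: "pos_semidef Q"
    show "f p / c * qtrace Q * qform X v \<le> qform (G Q) v"
    proof (cases "Q = 0")
      case True
      then show ?thesis
        using hermitian_linear_zero[OF positive_opD(1)[OF G]] by (simp add: qtrace_def)
    next
      case False
      have tr: "0 < qtrace Q" by (rule qtrace_pos_nonzero[OF Q False])
      have "f p / c * qform X v \<le> qform (G ((1 / qtrace Q) *\<^sub>R Q)) v"
        by (rule low[OF normalize_cone_base[OF Q False]])
      also have "\<dots> = qform (G Q) v / qtrace Q"
        using hermitian_linearD(3)[OF positive_opD(1)[OF G] pos_semidef_hermitian[OF Q]]
        by (simp add: qform_scaleR)
      finally show ?thesis using tr by (simp add: field_simps)
    qed
  qed
qed

text \<open>With \<open>m X \<le> H \<le> M X\<close>, apply the lower bound to \<open>H - m X\<close> and to \<open>M X - H\<close>: both ends move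
  inwards, by amounts that add up to \<open>d (M - m) qtrace X\<close>.\<close>

lemma oscillation_contraction:
  fixes G :: "complex^'n^'n \<Rightarrow> complex^'n^'n"
  assumes G: "positive_op G" and X: "pos_def X" "G X = X" and d: "0 < d"
    and low: "\<And>Q v. pos_semidef Q \<Longrightarrow> d * qtrace Q * qform X v \<le> qform (G Q) v"
    and H: "hermitian H" "\<And>v. m * qform X v \<le> qform H v" "\<And>v. qform H v \<le> M * qform X v"
  obtains m' M' where "m \<le> m'" "M' - m' = (1 - d * qtrace X) * (M - m)"
    "\<And>v. m' * qform X v \<le> qform (G H) v" "\<And>v. qform (G H) v \<le> M' * qform X v"
proof -
  note lin = hermitian_linear_diff[OF positive_opD(1)[OF G]]
    hermitian_linearD(3)[OF positive_opD(1)[OF G]]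
  have hX: "hermitian X" by (rule pos_def_hermitian[OF X(1)])
  have p1: "pos_semidef (H - m *\<^sub>R X)" and p2: "pos_semidef (M *\<^sub>R X - H)"
    using H hX by (auto intro!: pos_semidefI hermitian_intros simp: qform_simps)
  define m' where "m' = m + d * qtrace (H - m *\<^sub>R X)"
  define M' where "M' = M - d * qtrace (M *\<^sub>R X - H)"
  have GX: "G (c *\<^sub>R X) = c *\<^sub>R X" for c using lin(2)[OF hX] X(2) by simp
  have G1: "G (H - m *\<^sub>R X) = G H - m *\<^sub>R X"
    using lin(1)[OF H(1) hermitian_scaleR[OF hX]] GX by simp
  have G2: "G (M *\<^sub>R X - H) = M *\<^sub>R X - G H"
    using lin(1)[OF hermitian_scaleR[OF hX] H(1)] GX by simp
  show thesis
  proof (rule that[of m' M'])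
    show "m \<le> m'" using d qtrace_nonneg[OF p1] by (simp add: m'_def)
    show "M' - m' = (1 - d * qtrace X) * (M - m)"
      by (simp add: m'_def M'_def qtrace_diff qtrace_scaleR algebra_simps)
    show "m' * qform X v \<le> qform (G H) v" for v
      using low[OF p1, of v] unfolding G1 m'_def by (simp add: qform_simps distrib_right)
    show "qform (G H) v \<le> M' * qform X v" for v
      using low[OF p2, of v] unfolding G2 M'_def by (simp add: qform_simps left_diff_distrib)
  qed
qed

text \<open>The contraction factor depends on \<open>G\<close> and \<open>X\<close> only. The lower
  constant never falls below \<open>m\<close>, so a positive \<open>m\<close> remains usable as a
  divisor.\<close>

lemma oscillation_funpow:
  fixes G :: "complex^'n^'n \<Rightarrow> complex^'n^'n"
  assumes G: "positive_op G" and X: "pos_def X" "G X = X"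
    and pd: "\<And>Q. pos_semidef Q \<Longrightarrow> Q \<noteq> 0 \<Longrightarrow> pos_def (G Q)"
  obtains r where "0 < r" "r < 1"
    "\<And>H m M n. hermitian H \<Longrightarrow> (\<And>v. m * qform X v \<le> qform H v) \<Longrightarrow>
       (\<And>v. qform H v \<le> M * qform X v) \<Longrightarrow>
       \<exists>m' M'. m \<le> m' \<and> M' - m' = r ^ n * (M - m) \<and>
         (\<forall>v. m' * qform X v \<le> qform ((G ^^ n) H) v \<and> qform ((G ^^ n) H) v \<le> M' * qform X v)"
proof -
  obtain d0 where d0: "0 < d0" "\<And>Q v. pos_semidef Q \<Longrightarrow> d0 * qtrace Q * qform X v \<le> qform (G Q) v"
    using positive_definite_op_lower_bound[OF G pd pos_def_hermitian[OF X(1)]] by blast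
  have trX: "0 < qtrace X" by (rule qtrace_pos[OF X(1)])
  \<comment> \<open>The cut-off keeps the contraction factor at least 1/2, hence positive.\<close>
  define d where "d = min d0 (1 / (2 * qtrace X))"
  have d: "0 < d" using d0 trX by (simp add: d_def)
  have low: "d * qtrace Q * qform X v \<le> qform (G Q) v" if Q: "pos_semidef Q" for Q v
  proof -
    have "d * (qtrace Q * qform X v) \<le> d0 * (qtrace Q * qform X v)"
      using qtrace_nonneg[OF Q] pos_semidef_qform[OF pos_def_imp_pos_semidef[OF X(1)], of v]
      by (intro mult_right_mono) (auto simp: d_def)
    then show ?thesis using d0(2)[OF Q, of v] by (simp add: mult.assoc)
  qed
  define r where "r = 1 - d * qtrace X"
  have "d * qtrace X \<le> 1 / (2 * qtrace X) * qtrace X"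
    using trX by (intro mult_right_mono) (auto simp: d_def)
  then have r: "0 < r" "r < 1" using trX d by (auto simp: r_def)
  show thesis
  proof (rule that[OF r])
    fix H and m M :: real and n
    assume H: "hermitian H" "\<And>v. m * qform X v \<le> qform H v" "\<And>v. qform H v \<le> M * qform X v"
    show "\<exists>m' M'. m \<le> m' \<and> M' - m' = r ^ n * (M - m) \<and>
         (\<forall>v. m' * qform X v \<le> qform ((G ^^ n) H) v \<and> qform ((G ^^ n) H) v \<le> M' * qform X v)"
    proof (induction n)
      case 0
      show ?case using H by (intro exI[of _ m] exI[of _ M]) auto
    next
      case (Suc n)
      then obtain m1 M1 where 1: "m \<le> m1" "M1 - m1 = r ^ n * (M - m)"
        "\<And>v. m1 * qform X v \<le> qform ((G ^^ n) H) v" "\<And>v. qform ((G ^^ n) H) v \<le> M1 * qform X v"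
        by blast
      have "hermitian ((G ^^ n) H)"
        by (rule hermitian_linearD(1)[OF hermitian_linear_funpow[OF positive_opD(1)[OF G]] H(1)])
      then obtain m2 M2 where 2: "m1 \<le> m2" "M2 - m2 = r * (M1 - m1)"
        "\<And>v. m2 * qform X v \<le> qform (G ((G ^^ n) H)) v" "\<And>v. qform (G ((G ^^ n) H)) v \<le> M2 * qform X v"
        using oscillation_contraction[OF G X d low _ 1(3,4)] unfolding r_def[symmetric] by blast
      then show ?case using 1 by (intro exI[of _ m2] exI[of _ M2]) auto
    qed
  qed
qed

text \<open>Multiples of \<open>X\<close> are fixed, so monotonicity preserves the enclosure; this
  covers the steps between two contractions.\<close>

lemma positive_op_preserves_bounds:
  assumes F: "positive_op F" and X: "hermitian X" "F X = X" and H: "hermitian H"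
    and "\<And>v. m * qform X v \<le> qform H v" "\<And>v. qform H v \<le> M * qform X v"
  shows "m * qform X v \<le> qform ((F ^^ j) H) v" "qform ((F ^^ j) H) v \<le> M * qform X v"
proof -
  have Fj: "positive_op (F ^^ j)" by (rule positive_op_funpow[OF F])
  have "(F ^^ j) X = X" by (induction j) (simp_all add: X)
  then have FX: "qform ((F ^^ j) (c *\<^sub>R X)) v = c * qform X v" for c
    using hermitian_linearD(3)[OF positive_opD(1)[OF Fj] X(1)] by (simp add: qform_scaleR)
  show "m * qform X v \<le> qform ((F ^^ j) H) v" unfolding FX[symmetric]
    using assms by (intro positive_op_mono[OF Fj] hermitian_scaleR) (auto simp: qform_scaleR)
  show "qform ((F ^^ j) H) v \<le> M * qform X v" unfolding FX[symmetric]
    using assms by (intro positive_op_mono[OF Fj] hermitian_scaleR) (auto simp: qform_scaleR)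
qed

text \<open>Contraction occurs once per \<open>k0\<close> steps; the \<open>k0\<close>-th root of
  \<open>r\<close> spreads it over single steps. The offset and the remainder of the division cost
  fewer than \<open>2 * k0\<close> steps, whence the constant \<open>1 / r\<^sup>2\<close>.\<close>

lemma power_div_le:
  fixes r :: real
  assumes r: "0 < r" "r < 1" and k: "0 < (k0::nat)"
  obtains q C where "0 < q" "q < 1" "0 < C" "\<And>k. k0 \<le> k \<Longrightarrow> r ^ ((k - k0) div k0) \<le> C * q ^ k"
proof -
  define q where "q = root k0 r"
  have q: "0 < q" "q < 1" and qr: "q ^ k0 = r"
    using r k by (auto simp: q_def real_root_lt_1_iff)
  show thesis
  proof (rule that[OF q])
    show "0 < 1 / r\<^sup>2" using r by simp
    fix k assume kk: "k0 \<le> k"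
    have "k = k0 * ((k - k0) div k0) + (k - k0) mod k0 + k0" using kk by simp
    moreover have "(k - k0) mod k0 < k0" using k by simp
    ultimately have "k \<le> k0 * ((k - k0) div k0) + 2 * k0" by linarith
    then have "q ^ (k0 * ((k - k0) div k0) + 2 * k0) \<le> q ^ k"
      using q by (intro power_decreasing) auto
    moreover have "q ^ (k0 * ((k - k0) div k0) + 2 * k0) = r ^ ((k - k0) div k0) * r\<^sup>2"
      by (simp add: power_add power_mult qr power2_eq_square mult_2)
    ultimately show "r ^ ((k - k0) div k0) \<le> 1 / r\<^sup>2 * q ^ k"
      using r by (simp add: field_simps)
  qed
qed

text \<open>Dividing \<open>F\<close> by \<open>\<rho>\<close> gives an operator \<open>A\<close>
  fixing \<open>X\<close>. After \<open>k0\<close> steps the iterate lies between positive multiples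
  of \<open>X\<close>, and each further block of \<open>k0\<close> steps contracts this enclosure.
  At a generalised eigenvector the forms of two consecutive iterates of \<open>A\<close> lie in the
  enclosure and have ratio \<open>l * \<rho>\<close>, which is therefore close to 1.\<close>

lemma primitive_power_iteration:
  fixes F :: "complex^'n^'n \<Rightarrow> complex^'n^'n"
  assumes F: "positive_op F" and prim: "primitive_op F"
    and X: "pos_semidef X" "X \<noteq> 0" and eig: "F X = \<rho> *\<^sub>R X" and rho: "0 \<le> \<rho>"
  shows "0 < \<rho>"
    and "pos_semidef Q \<Longrightarrow> Q \<noteq> 0 \<Longrightarrow> \<forall>\<^sub>F k in sequentially. pos_def ((F ^^ k) Q)"
    and "pos_semidef Q \<Longrightarrow> Q \<noteq> 0 \<Longrightarrow> \<exists>C r. 0 < r \<and> r < 1 \<and>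
      (\<forall>\<^sub>F k in sequentially. \<forall>l \<in> gen_spectrum ((F ^^ k) Q) (F ((F ^^ k) Q)). \<bar>l - 1 / \<rho>\<bar> \<le> C * r ^ k)"
proof -
  obtain k0 where k0: "1 \<le> k0" "\<And>Q. pos_semidef Q \<Longrightarrow> Q \<noteq> 0 \<Longrightarrow> pos_def ((F ^^ k0) Q)"
    using prim unfolding primitive_op_def by blast
  have lin: "hermitian_linear F" by (rule positive_opD(1)[OF F])
  have FkX: "(F ^^ k) X = \<rho> ^ k *\<^sub>R X" for k
    by (induction k)
      (simp_all add: hermitian_linearD(3)[OF lin pos_semidef_hermitian[OF X(1)]] eig mult.commute)
  have pdX: "pos_def (\<rho> ^ k0 *\<^sub>R X)" using k0(2)[OF X] by (simp add: FkX)
  \<comment> \<open>As \<open>k0\<close> is at least 1, \<open>\<rho> = 0\<close> would make a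
    definite matrix zero.\<close>
  have "\<rho> \<noteq> 0" using pos_def_nonzero[OF pdX] k0(1) by (auto simp: power_0_left)
  then show rho: "0 < \<rho>" using rho by simp
  have Xpd: "pos_def X"
    using pdX rho by (auto simp: pos_def_def qform_scaleR zero_less_mult_iff pos_semidef_hermitian X)
  have hX: "hermitian X" by (rule pos_def_hermitian[OF Xpd])
  have nz: "F Q \<noteq> 0" if "pos_semidef Q" "Q \<noteq> 0" for Q
  proof
    assume 0: "F Q = 0"
    have "(F ^^ k0) Q = (F ^^ (k0 - 1)) (F Q)"
      using k0(1) by (metis One_nat_def Suc_pred comp_apply funpow_Suc_right le_eq_less_or_eq less_le_trans zero_less_one)
    then have "(F ^^ k0) Q = 0"
      using 0 hermitian_linear_zero[OF hermitian_linear_funpow[OF lin]] by simp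
    then show False using pos_def_nonzero[OF k0(2)[OF that]] by simp
  qed
  have pk: "pos_semidef ((F ^^ k) Q) \<and> (F ^^ k) Q \<noteq> 0" if "pos_semidef Q" "Q \<noteq> 0" for Q k
    by (induction k) (use that nz positive_opD(2)[OF F] in auto)
  have pd: "pos_def ((F ^^ k) Q)" if "pos_semidef Q" "Q \<noteq> 0" "k0 \<le> k" for Q k
  proof -
    have "(F ^^ k) Q = (F ^^ k0) ((F ^^ (k - k0)) Q)"
      using that(3) by (metis comp_apply funpow_add le_add_diff_inverse)
    then show ?thesis using k0(2) pk[OF that(1,2)] by simp
  qed
  then show "pos_semidef Q \<Longrightarrow> Q \<noteq> 0 \<Longrightarrow> \<forall>\<^sub>F k in sequentially. pos_def ((F ^^ k) Q)"
    unfolding eventually_sequentially by blast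
  assume Q: "pos_semidef Q" "Q \<noteq> 0"
  define A where "A = (\<lambda>Q. (1 / \<rho>) *\<^sub>R F Q)"
  have A: "positive_op A" unfolding A_def using rho by (intro positive_op_scaleR F) simp
  have linA: "hermitian_linear A" by (rule positive_opD(1)[OF A])
  have AX: "A X = X" using rho by (simp add: A_def eig)
  have FA: "(F ^^ k) Q = \<rho> ^ k *\<^sub>R (A ^^ k) Q" if "hermitian Q" for Q k
  proof (induction k)
    case (Suc k)
    have "hermitian ((A ^^ k) Q)" using hermitian_linearD(1)[OF hermitian_linear_funpow[OF linA] that] .
    then show ?case using Suc hermitian_linearD(3)[OF lin] rho by (simp add: A_def)
  qed simp
  have AkX: "(A ^^ k) X = X" for k by (induction k) (simp_all add: AX)
  have pdA: "pos_def ((A ^^ k0) Q)" if "pos_semidef Q" "Q \<noteq> 0" for Q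
  proof -
    have "pos_def (\<rho> ^ k0 *\<^sub>R (A ^^ k0) Q)"
      using k0(2)[OF that] FA[OF pos_semidef_hermitian[OF that(1)]] by simp
    then show ?thesis
      using rho hermitian_linearD(1)[OF hermitian_linear_funpow[OF linA] pos_semidef_hermitian[OF that(1)]]
      by (auto simp: pos_def_def qform_scaleR zero_less_mult_iff)
  qed
  have hQ: "hermitian Q" by (rule pos_semidef_hermitian[OF Q(1)])
  have hA: "hermitian ((A ^^ k) Q)" for k
    by (rule hermitian_linearD(1)[OF hermitian_linear_funpow[OF linA] hQ])
  define H where "H = (A ^^ k0) Q"
  have H: "pos_def H" "hermitian H" using pdA[OF Q] pos_def_hermitian by (auto simp: H_def)
  obtain M where M: "0 < M" "\<And>v. \<bar>qform H v\<bar> \<le> M * qform X v"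
    using pos_def_dominates[OF H(2) Xpd] by blast
  obtain c where c: "0 < c" "\<And>v. \<bar>qform X v\<bar> \<le> c * qform H v"
    using pos_def_dominates[OF hX H(1)] by blast
  \<comment> \<open>Domination of \<open>X\<close> by \<open>H\<close> gives a strictly positive
    lower constant.\<close>
  define m where "m = 1 / c"
  have m: "0 < m" "\<And>v. m * qform X v \<le> qform H v"
    using c(1) abs_le_D1[OF c(2)] by (auto simp: m_def field_simps)
  obtain r where r: "0 < r" "r < 1"
    "\<And>n. \<exists>m' M'. m \<le> m' \<and> M' - m' = r ^ n * (M - m) \<and>
      (\<forall>v. m' * qform X v \<le> qform (((A ^^ k0) ^^ n) H) v \<and> qform (((A ^^ k0) ^^ n) H) v \<le> M' * qform X v)"
    using oscillation_funpow[OF positive_op_funpow[OF A] Xpd AkX pdA] H(2) m(2) abs_le_D1[OF M(2)]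
    by metis
  have "0 < k0" using k0(1) by simp
  then obtain q C where q: "0 < q" "q < 1" "0 < C" "\<And>k. k0 \<le> k \<Longrightarrow> r ^ ((k - k0) div k0) \<le> C * q ^ k"
    using power_div_le[OF r(1,2)] by metis
  define D where "D = C * \<bar>M - m\<bar> / (\<rho> * m)"
  have bound: "\<bar>l - 1 / \<rho>\<bar> \<le> D * q ^ k"
    if k: "k0 \<le> k" and l: "l \<in> gen_spectrum ((F ^^ k) Q) (F ((F ^^ k) Q))" for k l
  proof -
    define n where "n = (k - k0) div k0"
    define j where "j = (k - k0) mod k0"
    \<comment> \<open>\<open>k0\<close> initial steps, \<open>n\<close> contracting blocks and a
      remainder \<open>j\<close>.\<close>
    have kn: "k = j + (k0 * n + k0)" using k by (simp add: n_def j_def)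
    obtain m' M' where b: "m \<le> m'" "M' - m' = r ^ n * (M - m)"
      "\<And>v. m' * qform X v \<le> qform (((A ^^ k0) ^^ n) H) v"
      "\<And>v. qform (((A ^^ k0) ^^ n) H) v \<le> M' * qform X v"
      using r(3)[of n] by blast
    have Ak: "(A ^^ i) Q = (A ^^ (i - (k0 * n + k0))) (((A ^^ k0) ^^ n) H)" if "k0 * n + k0 \<le> i" for i
    proof -
      have "((A ^^ k0) ^^ n) H = (A ^^ (k0 * n + k0)) Q"
        by (simp add: H_def funpow_add funpow_mult)
      then show ?thesis using that by (metis comp_apply funpow_add le_add_diff_inverse2)
    qed
    have hG: "hermitian (((A ^^ k0) ^^ n) H)"
      using hA[of "k0 * n + k0"] by (simp add: H_def funpow_add funpow_mult)
    note pb = positive_op_preserves_bounds[OF A hX AX hG b(3,4)]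
    \<comment> \<open>One enclosure serves both iterates \<open>k\<close> and \<open>Suc k\<close>,
      with the same constants.\<close>
    have "k0 * n + k0 \<le> k" "k0 * n + k0 \<le> Suc k" using kn by auto
    note bk = pb[where j = "k - (k0 * n + k0)", folded Ak[OF this(1)]]
      pb[where j = "Suc k - (k0 * n + k0)", folded Ak[OF this(2)]]
    obtain v where v: "v \<noteq> 0" "qform ((F ^^ k) Q) v = l * qform ((F ^^ Suc k) Q) v"
      using l by (auto elim: gen_spectrum_qform)
    have "qform ((A ^^ k) Q) v = l * \<rho> * qform ((A ^^ Suc k) Q) v"
      using v(2) rho unfolding FA[OF hQ] qform_scaleR by simp
    then obtain x a a' where xa: "0 < x" "a = l * \<rho> * a'" "m' * x \<le> a" "a \<le> M' * x" "m' * x \<le> a'" "a' \<le> M' * x"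
      using bk[of v] pos_def_qform[OF Xpd v(1)] by metis
    have m'0: "0 < m'" using b(1) m(1) by simp
    have a0: "0 < a" "0 < a'" using m'0 xa by (meson less_le_trans mult_pos_pos)+
    have mM: "0 \<le> M' - m'" using xa by (meson diff_ge_0_iff_ge mult_le_cancel_right_pos order_trans)
    have "\<bar>a - a'\<bar> \<le> (M' - m') * x" using xa by (simp add: algebra_simps)
    \<comment> \<open>Replacing \<open>m'\<close> by \<open>m\<close>, which is independent of
      \<open>k\<close>, keeps the final constant uniform.\<close>
    also have "\<dots> \<le> (M' - m') * (a' / m)"
    proof (rule mult_left_mono[OF _ mM])
      have "m * x \<le> m' * x" using b(1) xa(1) by simp
      then show "x \<le> a' / m" using xa(5) m(1) by (simp add: field_simps)
    qed
    finally have "\<bar>a - a'\<bar> / a' \<le> (M' - m') / m" using a0 by (simp add: field_simps)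
    moreover have "\<bar>a - a'\<bar> / a' = \<bar>l * \<rho> - 1\<bar>"
    proof -
      have "a - a' = (l * \<rho> - 1) * a'" using xa(2) by (simp add: algebra_simps)
      then show ?thesis using a0 by (simp add: abs_mult)
    qed
    ultimately have "\<bar>l * \<rho> - 1\<bar> \<le> (M' - m') / m" by simp
    moreover have "\<bar>l * \<rho> - 1\<bar> = \<rho> * \<bar>l - 1 / \<rho>\<bar>"
    proof -
      have "l * \<rho> - 1 = \<rho> * (l - 1 / \<rho>)" using rho by (simp add: field_simps)
      then show ?thesis using rho by (simp add: abs_mult)
    qed
    ultimately have "\<bar>l - 1 / \<rho>\<bar> \<le> (M' - m') / (\<rho> * m)" using rho m(1) by (simp add: field_simps)
    also have "\<dots> \<le> (C * q ^ k) * \<bar>M - m\<bar> / (\<rho> * m)"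
    proof (rule divide_right_mono)
      have "M' - m' \<le> r ^ n * \<bar>M - m\<bar>" unfolding b(2) using r(1) by (intro mult_left_mono) auto
      also have "\<dots> \<le> (C * q ^ k) * \<bar>M - m\<bar>"
        unfolding n_def by (intro mult_right_mono q(4) k) simp
      finally show "M' - m' \<le> (C * q ^ k) * \<bar>M - m\<bar>" .
    qed (use rho m(1) in simp)
    also have "\<dots> = D * q ^ k" by (simp add: D_def)
    finally show ?thesis .
  qed
  show "\<exists>C r. 0 < r \<and> r < 1 \<and>
      (\<forall>\<^sub>F k in sequentially. \<forall>l \<in> gen_spectrum ((F ^^ k) Q) (F ((F ^^ k) Q)). \<bar>l - 1 / \<rho>\<bar> \<le> C * r ^ k)"
    using q(1,2) bound unfolding eventually_sequentially
    by (intro exI[of _ D] exI[of _ q]) blast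
qed

section \<open>Geometric convergence and the four claims for \<open>S\<close>\<close>

lemma geometric_bound_tendsto:
  fixes f :: "nat \<Rightarrow> real"
  assumes "0 < r" "r < 1" "\<forall>\<^sub>F k in sequentially. \<bar>f k - p\<bar> \<le> C * r ^ k"
  shows "f \<longlonglongrightarrow> p"
proof -
  have "(\<lambda>k. C * r ^ k) \<longlonglongrightarrow> 0"
    using assms by (intro tendsto_mult_right_zero LIMSEQ_power_zero) auto
  then have "(\<lambda>k. f k - p) \<longlonglongrightarrow> 0"
    using assms(3) by (intro Lim_null_comparison[of "\<lambda>k. f k - p"]) simp_all
  then show ?thesis by (simp add: LIM_zero_iff)
qed

theorem theorem5p1:
  fixes L :: "complex^'n^'n"
    and V S :: "complex^'n^'n \<Rightarrow> complex^'n^'n"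
    and P :: ereal
    and \<sigma> :: "complex^'n^'n \<Rightarrow> real set"
  assumes L_inv: "invertible L"
    and V_linear: "hermitian_linear V"
    and V_pos: "\<And>Q. pos_semidef Q \<Longrightarrow> pos_semidef (V Q)"
    and P_def: "P = (SUP Q\<in>{Q. pos_def Q}. INF v\<in>{v. v \<noteq> 0}.
                       ext_quotient (qform Q (L *v v)) (qform (V Q) v))"
    and S_def: "S = (\<lambda>Q. V (conj_transpose (matrix_inv L) ** Q ** matrix_inv L))"
    and \<sigma>_def: "\<sigma> = (\<lambda>Q. gen_spectrum Q (S Q))"
  shows
    "((\<forall>Q. pos_semidef Q \<longrightarrow> pos_semidef (S Q)) \<and>
     0 \<le> spec_rad S \<and>
     complex_of_real (spec_rad S) \<in> spectrum_herm S \<and>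
     (\<forall>\<mu>\<in>spectrum_herm S. cmod \<mu> \<le> spec_rad S) \<and>
     (\<exists>Q. Q \<noteq> 0 \<and> pos_semidef Q \<and> S Q = spec_rad S *\<^sub>R Q)) \<and>
     (0 < P \<and> ereal (spec_rad S) = 1 / P) \<and>
     (\<forall>Q. pos_semidef Q \<longrightarrow> pos_def (S Q) \<longrightarrow>
       finite (\<sigma> Q) \<and> \<sigma> Q \<noteq> {} \<and>
       ereal (Min (\<sigma> Q)) \<le> P \<and> P \<le> ereal (Max (\<sigma> Q))) \<and>
     (primitive_op S \<longrightarrow>
       \<bar>P\<bar> \<noteq> \<infinity> \<and>
       (\<forall>Q. pos_semidef Q \<longrightarrow> Q \<noteq> 0 \<longrightarrow>
         (\<forall>\<^sub>F k in sequentially. finite (\<sigma> ((S ^^ k) Q)) \<and> \<sigma> ((S ^^ k) Q) \<noteq> {}) \<and>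
         (\<lambda>k. ereal (Min (\<sigma> ((S ^^ k) Q)))) \<longlonglongrightarrow> P \<and>
         (\<lambda>k. ereal (Max (\<sigma> ((S ^^ k) Q)))) \<longlonglongrightarrow> P \<and>
         (\<exists>C r. 0 < r \<and> r < 1 \<and>
           (\<forall>\<^sub>F k in sequentially.
              \<bar>Min (\<sigma> ((S ^^ k) Q)) - real_of_ereal P\<bar> \<le> C * r ^ k \<and>
              \<bar>Max (\<sigma> ((S ^^ k) Q)) - real_of_ereal P\<bar> \<le> C * r ^ k))))"
proof -
  have S: "positive_op S"
    unfolding S_def using V_linear V_pos by (intro positive_op_congruence) (simp add: positive_op_def)
  have P: "P = collatz_wielandt S"
    unfolding P_def by (rule collatz_wielandt_congruence[OF L_inv S_def])
  obtain X r where X: "pos_semidef X" "X \<noteq> 0" and r: "0 \<le> r" and eig: "S X = r *\<^sub>R X"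
    and approx: "\<And>s. r < s \<Longrightarrow> \<exists>R. pos_def R \<and> (\<forall>v. qform (S R) v \<le> s * qform R v)"
    using leading_eigenmatrix[OF S] by blast
  note spec = leading_eigenvalue_spec_rad[OF S X r eig approx]
  have Pr: "P = (if r = 0 then \<infinity> else ereal (1 / r))"
    unfolding P by (rule collatz_wielandt_eq[OF S X r eig approx])
  have a: "(\<forall>Q. pos_semidef Q \<longrightarrow> pos_semidef (S Q)) \<and>
     0 \<le> spec_rad S \<and>
     complex_of_real (spec_rad S) \<in> spectrum_herm S \<and>
     (\<forall>\<mu>\<in>spectrum_herm S. cmod \<mu> \<le> spec_rad S) \<and>
     (\<exists>Q. Q \<noteq> 0 \<and> pos_semidef Q \<and> S Q = spec_rad S *\<^sub>R Q)"
    using positive_opD(2)[OF S] X r eig spec by auto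
  \<comment> \<open>For \<open>r = 0\<close> this is the convention that
    \<open>1 / \<infinity>\<close> is 0.\<close>
  have b: "0 < P \<and> ereal (spec_rad S) = 1 / P"
    using r by (auto simp: spec(1) Pr one_ereal_def)
  have fin: "finite (\<sigma> Q) \<and> \<sigma> Q \<noteq> {}" if "pos_semidef Q" "pos_def (S Q)" for Q
    using finite_gen_spectrum gen_spectrum_nonempty pos_semidef_hermitian that unfolding \<sigma>_def by blast
  have c: "ereal (Min (\<sigma> Q)) \<le> P \<and> P \<le> ereal (Max (\<sigma> Q))" if "pos_semidef Q" "pos_def (S Q)" for Q
    using collatz_wielandt_bounds[OF S that] by (simp add: P \<sigma>_def)
  have d: "\<bar>P\<bar> \<noteq> \<infinity> \<and>
       (\<forall>Q. pos_semidef Q \<longrightarrow> Q \<noteq> 0 \<longrightarrow>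
         (\<forall>\<^sub>F k in sequentially. finite (\<sigma> ((S ^^ k) Q)) \<and> \<sigma> ((S ^^ k) Q) \<noteq> {}) \<and>
         (\<lambda>k. ereal (Min (\<sigma> ((S ^^ k) Q)))) \<longlonglongrightarrow> P \<and>
         (\<lambda>k. ereal (Max (\<sigma> ((S ^^ k) Q)))) \<longlonglongrightarrow> P \<and>
         (\<exists>C r. 0 < r \<and> r < 1 \<and>
           (\<forall>\<^sub>F k in sequentially.
              \<bar>Min (\<sigma> ((S ^^ k) Q)) - real_of_ereal P\<bar> \<le> C * r ^ k \<and>
              \<bar>Max (\<sigma> ((S ^^ k) Q)) - real_of_ereal P\<bar> \<le> C * r ^ k)))"
    if prim: "primitive_op S"
  proof (intro conjI allI impI)
    note it = primitive_power_iteration[OF S prim X eig r]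
    have P1: "P = ereal (1 / r)" using it(1) by (simp add: Pr)
    then show "\<bar>P\<bar> \<noteq> \<infinity>" by simp
    fix Q :: "complex^'n^'n" assume Q: "pos_semidef Q" "Q \<noteq> 0"
    \<comment> \<open>The spectrum of each iterate is taken against the next one, so definiteness at
      \<open>Suc k\<close> is needed too.\<close>
    have "\<forall>\<^sub>F k in sequentially. pos_def ((S ^^ k) Q) \<and> pos_def (S ((S ^^ k) Q))"
      using it(2)[OF Q] eventually_sequentially_Suc[of "\<lambda>k. pos_def ((S ^^ k) Q)"]
      by (simp add: eventually_conj_iff)
    then show ev: "\<forall>\<^sub>F k in sequentially. finite (\<sigma> ((S ^^ k) Q)) \<and> \<sigma> ((S ^^ k) Q) \<noteq> {}"
      by (rule eventually_mono) (use fin pos_def_imp_pos_semidef in blast)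
    obtain C q where q: "0 < q" "q < 1"
      "\<forall>\<^sub>F k in sequentially. \<forall>l \<in> \<sigma> ((S ^^ k) Q). \<bar>l - 1 / r\<bar> \<le> C * q ^ k"
      using it(3)[OF Q] unfolding \<sigma>_def by blast
    \<comment> \<open>Minimum and maximum of a finite non-empty set belong to it, so the uniform
      bound on all generalised eigenvalues covers both.\<close>
    have mM: "\<forall>\<^sub>F k in sequentially.
        \<bar>Min (\<sigma> ((S ^^ k) Q)) - 1 / r\<bar> \<le> C * q ^ k \<and> \<bar>Max (\<sigma> ((S ^^ k) Q)) - 1 / r\<bar> \<le> C * q ^ k"
      using ev q(3) by eventually_elim simp
    have "(\<lambda>k. Min (\<sigma> ((S ^^ k) Q))) \<longlonglongrightarrow> 1 / r" "(\<lambda>k. Max (\<sigma> ((S ^^ k) Q))) \<longlonglongrightarrow> 1 / r"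
      using mM by (auto intro!: geometric_bound_tendsto[OF q(1,2), of _ _ C] elim: eventually_mono)
    then show "(\<lambda>k. ereal (Min (\<sigma> ((S ^^ k) Q)))) \<longlonglongrightarrow> P" "(\<lambda>k. ereal (Max (\<sigma> ((S ^^ k) Q)))) \<longlonglongrightarrow> P"
      unfolding P1 by (auto intro: tendsto_intros)
    show "\<exists>C r. 0 < r \<and> r < 1 \<and>
           (\<forall>\<^sub>F k in sequentially.
              \<bar>Min (\<sigma> ((S ^^ k) Q)) - real_of_ereal P\<bar> \<le> C * r ^ k \<and>
              \<bar>Max (\<sigma> ((S ^^ k) Q)) - real_of_ereal P\<bar> \<le> C * r ^ k)"
      using q(1,2) mM unfolding P1 by (intro exI[of _ C] exI[of _ q]) simp
  qed
  show ?thesis using a b c d fin by blast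
qed

end
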